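(* Let each $f_i:\mathbb{R}^p\to\mathbb{R}$ ($i=1,\dots,n$) be $\mu_i$-strongly convex and $L_i$-smooth, and let the stochastic gradients satisfy the stochastic gradient assumption with constant $\sigma>0$. Let $\bar{x}_k=\frac1n\sum_{i=1}^nx_{i,k}$ be the average iterates produced by the stochastic NEAR-DGD$^+$ method with steplength $\alpha\le\min_i\big(\frac{2}{\mu_i+L_i}\big)$. Then $\bar{x}_k$ converges in expectation to a neighborhood of the solution $x^\star=\arg\min_{x\in\mathbb{R}^p}\sum_{i=1}^nf_i(x)$ with linear rate: for all $k=0,1,2,\dots$ $$\mathbb{E}[\|\bar{x}_k-x^\star\|^2]\le C\theta^k+\frac{\alpha^2\sigma^2}{n(1-c_1)},$$ where $$C=\max\Big\{\|\bar{x}_0-x^\star\|^2,\frac{2c_2^2}{1-c_1}\Big\},\qquad \theta=\max\Big\{\beta^2,\frac{c_1+1}{2}\Big\}.$$ Here $c_1=(1+\psi)(1-2\alpha\gamma_{\bar f})$, $\psi<\frac{2\alpha\gamma_{\bar f}}{1-2\alpha\gamma_{\bar f}}$ is a positive constant, $\gamma_{\bar f}=\frac{\mu_{\bar f}L_{\bar f}}{\mu_{\bar f}+L_{\bar f}}$ with $\mu_{\bar f}=\frac1n\sum_{i=1}^n\mu_i$ and $L_{\bar f}=\frac1n\sum_{i=1}^nL_i$, and $c_2^2=\alpha^2(1+\psi^{-1})L^2D^2$.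
   Context: Setting: $n$ agents in a connected network; agent $i$ holds $f_i$. $L_i$-smooth means the gradient is $L_i$-Lipschitz. Consensus matrix: $\mathbf{W}\in\mathbb{R}^{n\times n}$ is symmetric and doubly stochastic with strictly positive diagonal entries; its off-diagonal entries $w_{ij}$ are strictly positive if and only if agents $i$ and $j$ are connected, and zero otherwise. $\beta$ is the second largest singular value of $\mathbf{W}$. $\mathbf{Z}=\mathbf{W}\otimes I_p\in\mathbb{R}^{np\times np}$, where $I_p$ is the identity matrix. Stochastic NEAR-DGD$^+$ (the number of consensus steps increases by one at every iteration, $t(k)=k$), with constant steplength $\alpha>0$: from an initial point $\mathbf{y}_0=[y_{1,0},\dots,y_{n,0}]\in\mathbb{R}^{np}$, for $k=0,1,2,\dots$ $$\mathbf{x}_k=\mathbf{Z}^{k}\mathbf{y}_k,\qquad \mathbf{y}_{k+1}=\mathbf{x}_k-\alpha\,\mathbf{g}(\mathbf{x}_k,\boldsymbol{\xi}_k),$$ where $\mathbf{x}_k=[x_{1,k},\dots,x_{n,k}]$ and $\mathbf{y}_k=[y_{1,k},\dots,y_{n,k}]$ are concatenations of local variables in $\mathbb{R}^p$, and $\mathbf{g}(\mathbf{x}_k,\boldsymbol{\xi}_k)$ is the concatenation of the local stochastic gradients $g_i(x_{i,k},\xi_{i,k})\in\mathbb{R}^p$. Stochastic gradient assumption: $g_i(x_{i,k},\xi_{i,k})$ is the stochastic gradient computed at agent $i$ at iteration $k$ and $\xi_{i,k}$ is a random vector; for all $i=1,\dots,n$ and $k=0,1,2,\dots$, $$\mathbb{E}[g_i(x_{i,k},\xi_{i,k})\mid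 x_{i,k}]=\nabla f_i(x_{i,k}),\qquad \mathbb{E}[\|g_i(x_{i,k},\xi_{i,k})-\nabla f_i(x_{i,k})\|^2\mid x_{i,k}]\le\sigma^2.$$ Constants: $L=\max_iL_i$; $D^2=2\|\mathbf{y}_0-\mathbf{u}^\star\|^2+\frac{8+2\nu^3}{\nu^3}\|\mathbf{u}^\star\|^2+\frac{2}{\nu^2}\Delta$, where $\mathbf{u}^\star=[u_1^\star,\dots,u_n^\star]$, $u_i^\star=\arg\min_{u}f_i(u)$, $\nu=2\alpha\gamma$, $\gamma=\min_i\frac{\mu_iL_i}{\mu_i+L_i}$, $\Delta=n\alpha^2\sigma^2$.
   Formalization: Added assumption: at each iteration k the samples ξ_{1,k},…,ξ_{n,k} are independent across agents and jointly independent of x_k; without it the bound fails, e.g. for n=2 equal quadratics with the same additive noise at both agents and small ψ. *)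

theory Defs
  imports "HOL-Probability.Probability"
begin

subsection \<open>Functions on Euclidean space\<close>

definition grad :: "('a::real_inner \<Rightarrow> real) \<Rightarrow> 'a \<Rightarrow> 'a" where
  "grad f x = (THE D. GDERIV f x :> D)"

definition L_smooth :: "real \<Rightarrow> ('a::real_inner \<Rightarrow> real) \<Rightarrow> bool" where
  "L_smooth L f \<longleftrightarrow> (\<forall>x. GDERIV f x :> grad f x) \<and> L-lipschitz_on UNIV (grad f)"

definition strongly_convex :: "real \<Rightarrow> ('a::real_inner \<Rightarrow> real) \<Rightarrow> bool" where
  "strongly_convex \<mu> f \<longleftrightarrow> \<mu> > 0 \<and> convex_on UNIV (\<lambda>x. f x - \<mu> / 2 * (norm x)\<^sup>2)"

definition argmin :: "('a \<Rightarrow> real) \<Rightarrow> 'a" where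
  "argmin f = (ARG_MIN f x. True)"

subsection \<open>Matrices\<close>

(* The library's ^ on the type real^'n^'n is the entrywise power. *)
primrec matpow :: "real^'n^'n \<Rightarrow> nat \<Rightarrow> real^'n^'n" where
  "matpow A 0 = mat 1"
| "matpow A (Suc k) = A ** matpow A k"

definition kron :: "real^'n::finite^'m::finite \<Rightarrow> real^'q::finite^'p::finite \<Rightarrow> real^('n \<times> 'q)^('m \<times> 'p)" where
  "kron A B = (\<chi> r c. A $ fst r $ fst c * B $ snd r $ snd c)"

(* Number of singular values of A equal to s, for s >= 0: the multiplicity of s^2 as an
   eigenvalue of A^T A (geometric and algebraic multiplicity agree, as A^T A is symmetric). *)
definition singular_mult :: "real^'n^'m \<Rightarrow> real \<Rightarrow> nat" where
  "singular_mult A s = dim {v. (transpose A ** A) *v v = s\<^sup>2 *\<^sub>R v}"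

(* In decreasing order, repeated according to multiplicity. *)
definition singular_values :: "real^'n^'m \<Rightarrow> real list" where
  "singular_values A = rev (sorted_list_of_multiset
     (\<Sum>s\<in>{s. 0 \<le> s \<and> singular_mult A s > 0}. replicate_mset (singular_mult A s) s))"

(* A 1 x 1 matrix has only one singular value; the value is then 0 by convention. *)
definition second_singular_value :: "real^'n^'n \<Rightarrow> real" where
  "second_singular_value A =
     (if length (singular_values A) \<ge> 2 then singular_values A ! 1 else 0)"

subsection \<open>The network\<close>

definition connected_network :: "('n \<times> 'n) set \<Rightarrow> bool" where
  "connected_network E \<longleftrightarrow> sym E \<and> irrefl E \<and> (\<forall>i j. (i, j) \<in> E\<^sup>*)"

definition consensus_matrix :: "('n \<times> 'n) set \<Rightarrow> real^'n^'n \<Rightarrow> bool" where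
  "consensus_matrix E W \<longleftrightarrow>
     transpose W = W \<and>
     (\<forall>i j. W $ i $ j \<ge> 0) \<and> (\<forall>i. (\<Sum>j\<in>UNIV. W $ i $ j) = 1) \<and> (\<forall>j. (\<Sum>i\<in>UNIV. W $ i $ j) = 1) \<and>
     (\<forall>i. W $ i $ i > 0) \<and>
     (\<forall>i j. i \<noteq> j \<longrightarrow> (if (i, j) \<in> E then W $ i $ j > 0 else W $ i $ j = 0))"

subsection \<open>Concatenation of local vectors\<close>

definition stack :: "('n::finite \<Rightarrow> real^'p::finite) \<Rightarrow> real^('n \<times> 'p)" where
  "stack u = (\<chi> r. u (fst r) $ snd r)"

definition block :: "real^('n::finite \<times> 'p::finite) \<Rightarrow> 'n \<Rightarrow> real^'p" where
  "block x i = (\<chi> j. x $ (i, j))"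

definition avg :: "real^('n::finite \<times> 'p::finite) \<Rightarrow> real^'p" where
  "avg x = (1 / real CARD('n)) *\<^sub>R (\<Sum>i\<in>UNIV. block x i)"

subsection \<open>Stochastic gradients\<close>

definition gen_alg :: "'w measure \<Rightarrow> 'b measure \<Rightarrow> ('w \<Rightarrow> 'b) \<Rightarrow> 'w measure" where
  "gen_alg M N X = vimage_algebra (space M) X N"

definition vec_cond_exp :: "'w measure \<Rightarrow> 'w measure \<Rightarrow> ('w \<Rightarrow> real^'p) \<Rightarrow> 'w \<Rightarrow> real^'p" where
  "vec_cond_exp M F G \<omega> = (\<chi> j. real_cond_exp M F (\<lambda>\<omega>'. G \<omega>' $ j) \<omega>)"

(* Integrability of G is required since real_cond_exp is only meaningful for integrable arguments. *)
definition stochastic_gradient ::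
    "'w measure \<Rightarrow> real \<Rightarrow> (real^'p \<Rightarrow> real) \<Rightarrow> ('w \<Rightarrow> real^'p) \<Rightarrow> ('w \<Rightarrow> real^'p) \<Rightarrow> bool" where
  "stochastic_gradient M \<sigma> f X G \<longleftrightarrow>
     integrable M G \<and>
     (AE \<omega> in M. vec_cond_exp M (gen_alg M borel X) G \<omega> = grad f (X \<omega>)) \<and>
     (AE \<omega> in M. nn_cond_exp M (gen_alg M borel X)
         (\<lambda>\<omega>'. ennreal ((norm (G \<omega>' - grad f (X \<omega>')))\<^sup>2)) \<omega> \<le> ennreal (\<sigma>\<^sup>2))"

(* The samples drawn in one iteration are independent across agents and of the current iterate X.
   The library's indep_var is restricted to two random variables of the same type. *)
definition fresh_samples ::
    "'w measure \<Rightarrow> ('w \<Rightarrow> 'x::euclidean_space) \<Rightarrow> ('n \<Rightarrow> 'w \<Rightarrow> 'd::euclidean_space) \<Rightarrow> bool" where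
  "fresh_samples M X \<xi> \<longleftrightarrow>
     prob_space.indep_vars M (\<lambda>_. borel) \<xi> UNIV \<and>
     prob_space.indep_set M (sets (gen_alg M borel X))
       (sets (gen_alg M (PiM UNIV (\<lambda>_. borel)) (\<lambda>\<omega> i. \<xi> i \<omega>)))"

end

theory Submission
  imports Defs
begin

text \<open>
  By strong cocoercivity of the gradients, an exact local gradient step contracts the squared
  distance to the local minimizer by \<open>1 - \<nu>\<close>, while mixing with a power of the doubly
  stochastic matrix is nonexpansive up to an offset proportional to \<open>|u\<^sup>\<star>|\<close>; with Young's
  inequality with parameter \<open>\<nu>\<close> this bounds \<open>E |y\<^sub>k|\<^sup>2\<close> by \<open>D\<^sup>2\<close> uniformly in \<open>k\<close>.
  Averaging commutes with mixing, and the local copies disagree with their average by at most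
  \<open>\<beta>\<^sup>k |y\<^sub>k|\<close>. Hence the average follows a gradient step for the averaged objective up to an error of
  second moment at most \<open>c\<^sub>2\<^sup>2 \<beta>\<^sup>2\<^sup>k\<close> (after Young with parameter \<open>\<psi>\<close>) and independent centered noise
  of variance at most \<open>\<alpha>\<^sup>2\<sigma>\<^sup>2/n\<close>, so that
  \<open>e\<^sub>k\<^sub>+\<^sub>1 \<le> c\<^sub>1 e\<^sub>k + c\<^sub>2\<^sup>2 \<beta>\<^sup>2\<^sup>k + \<alpha>\<^sup>2\<sigma>\<^sup>2/n\<close>, and the claim follows by induction.
\<close>

subsection \<open>Strongly convex functions with Lipschitz gradient\<close>

text \<open>The stochastic gradient assumption treats the agents one by one and conditions on an
  agent's own iterate only, whereas expanding a squared norm needs noise that is centered given the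
  whole vector \<open>x k\<close> and uncorrelated between agents. \<open>fresh_samples\<close>
  closes this gap: iterate and samples have a product law, so by Fubini the iterate may be frozen
  while the samples are averaged. The n independent noise terms, each weighted by \<alpha>/n, then
  have total variance at most \<alpha>^2 \<sigma>^2 / n.

  The local minimizers differ, so mixing does not fix \<open>ustar\<close>; the resulting offset
  recurs in every iteration and is balanced only by the contraction. Young with parameter \<nu>
  turns the factor 1 - \<nu> into (1 - \<nu>)(1 + \<nu>) = 1 - \<nu>^2, and dividing an offset of
  order 1/\<nu> by the gap \<nu>^2 produces the \<nu>^3 in \<open>Dsq\<close>.

  In the final recursion half of the gap 1 - \<open>c1\<close> absorbs the decaying disagreement;
  this explains both the factor 2 / (1 - \<open>c1\<close>) in \<open>C\<close> and the rate
  (\<open>c1\<close> + 1) / 2 in \<theta>.\<close>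

lemma GDERIV_along_line:
  fixes F :: "'a::real_inner \<Rightarrow> real"
  assumes "\<And>x. GDERIV F x :> G x"
  shows "((\<lambda>t. F (x + t *\<^sub>R d)) has_real_derivative (G (x + t *\<^sub>R d) \<bullet> d)) (at t within T)"
proof -
  have "((\<lambda>t. x + t *\<^sub>R d) has_derivative (\<lambda>s. s *\<^sub>R d)) (at t within T)"
    by (auto intro!: derivative_eq_intros)
  from has_derivative_compose[OF this assms[unfolded gderiv_def]]
  have "((\<lambda>t. F (x + t *\<^sub>R d)) has_derivative (\<lambda>s. (s *\<^sub>R d) \<bullet> G (x + t *\<^sub>R d))) (at t within T)" .
  then show ?thesis
    by (simp add: has_field_derivative_def inner_commute mult_commute_abs)
qed

text \<open>The descent lemma. Along the segment, the gap between \<open>F\<close> and its quadratic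
  bound has derivative (G(x + td) - G(x)) . d - L t |d|^2, nonpositive by Cauchy-Schwarz and the
  Lipschitz bound; comparing t = 0 with t = 1 avoids integration.\<close>

lemma lipschitz_gradient_upper_bound:
  fixes F :: "'a::real_inner \<Rightarrow> real"
  assumes grad: "\<And>x. GDERIV F x :> G x" and lip: "L-lipschitz_on UNIV G"
  shows "F (x + d) \<le> F x + G x \<bullet> d + L / 2 * (norm d)\<^sup>2"
proof -
  define \<phi> where "\<phi> t = F (x + t *\<^sub>R d) - t * (G x \<bullet> d) - L / 2 * t\<^sup>2 * (norm d)\<^sup>2" for t
  have "\<phi> 1 \<le> \<phi> 0"
  proof (rule DERIV_nonpos_imp_nonincreasing[of 0 1])
    fix t :: real assume t: "0 \<le> t" "t \<le> 1"
    have "(\<phi> has_real_derivative ((G (x + t *\<^sub>R d) \<bullet> d) - (G x \<bullet> d) - L * t * (norm d)\<^sup>2)) (at t)"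
      unfolding \<phi>_def by (auto intro!: derivative_eq_intros GDERIV_along_line[OF grad])
    moreover have "G (x + t *\<^sub>R d) \<bullet> d - G x \<bullet> d \<le> L * t * (norm d)\<^sup>2"
    proof -
      have "G (x + t *\<^sub>R d) \<bullet> d - G x \<bullet> d = (G (x + t *\<^sub>R d) - G x) \<bullet> d"
        by (simp add: inner_diff_left)
      also have "\<dots> \<le> norm (G (x + t *\<^sub>R d) - G x) * norm d"
        by (rule norm_cauchy_schwarz)
      also have "\<dots> \<le> (L * (t * norm d)) * norm d"
        using lipschitz_onD[OF lip, of "x + t *\<^sub>R d" x] t
        by (intro mult_right_mono) (auto simp: dist_norm)
      finally show ?thesis by (simp add: power2_eq_square mult_ac)
    qed
    ultimately show "\<exists>z. DERIV \<phi> t :> z \<and> z \<le> 0" by fastforce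
  qed auto
  then show ?thesis by (simp add: \<phi>_def)
qed

text \<open>This is the tangent inequality, based at t = 0 and read at t = 1, for the convex
  function \<open>F\<close> minus quadratic restricted to a line.\<close>

lemma strongly_convex_lower_bound:
  fixes F :: "'a::real_inner \<Rightarrow> real"
  assumes grad: "\<And>x. GDERIV F x :> G x" and conv: "strongly_convex \<mu> F"
  shows "F x + G x \<bullet> d + \<mu> / 2 * (norm d)\<^sup>2 \<le> F (x + d)"
proof -
  define H where "H x = F x - \<mu> / 2 * (norm x)\<^sup>2" for x
  define \<phi> where "\<phi> t = H (x + t *\<^sub>R d)" for t :: real
  have H: "convex_on UNIV H"
    using conv unfolding strongly_convex_def H_def by blast
  have "convex_on UNIV \<phi>"
  proof (rule convex_onI)
    fix t a b :: real assume "0 < t" "t < 1"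
    have "x + ((1 - t) *\<^sub>R a + t *\<^sub>R b) *\<^sub>R d = (1 - t) *\<^sub>R (x + a *\<^sub>R d) + t *\<^sub>R (x + b *\<^sub>R d)"
      by (simp add: algebra_simps)
    then show "\<phi> ((1 - t) *\<^sub>R a + t *\<^sub>R b) \<le> (1 - t) * \<phi> a + t * \<phi> b"
      unfolding \<phi>_def using convex_onD[OF H, of t "x + a *\<^sub>R d" "x + b *\<^sub>R d"] \<open>0 < t\<close> \<open>t < 1\<close> by simp
  qed auto
  moreover have "\<phi> = (\<lambda>t. F (x + t *\<^sub>R d) - \<mu> / 2 * ((norm x)\<^sup>2 + 2 * t * (x \<bullet> d) + t\<^sup>2 * (norm d)\<^sup>2))"
    unfolding fun_eq_iff \<phi>_def H_def power2_norm_eq_inner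
    by (simp add: inner_commute algebra_simps power2_eq_square)
  moreover have "((\<lambda>t. F (x + t *\<^sub>R d) - \<mu> / 2 * ((norm x)\<^sup>2 + 2 * t * (x \<bullet> d) + t\<^sup>2 * (norm d)\<^sup>2))
      has_real_derivative (G (x + 0 *\<^sub>R d) \<bullet> d - \<mu> * (x \<bullet> d))) (at 0)"
    by (rule derivative_eq_intros GDERIV_along_line[OF grad] refl | simp)+
  ultimately have "\<phi> 1 - \<phi> 0 \<ge> (G (x + 0 *\<^sub>R d) \<bullet> d - \<mu> * (x \<bullet> d)) * (1 - 0)"
    by (intro convex_on_imp_above_tangent[of UNIV]) auto
  then show ?thesis
    by (simp add: \<phi>_def H_def power2_norm_eq_inner inner_commute algebra_simps)
qed

text \<open>The upper and the lower quadratic bound are compared along a unit vector, which exists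
  because Euclidean spaces here have positive dimension.\<close>

lemma strongly_convex_le_lipschitz:
  fixes F :: "'a::euclidean_space \<Rightarrow> real"
  assumes grad: "\<And>x. GDERIV F x :> G x" and lip: "L-lipschitz_on UNIV G"
    and conv: "strongly_convex \<mu> F"
  shows "\<mu> \<le> L"
proof -
  obtain d :: 'a where "norm d = 1" using vector_choose_size[of 1] by auto
  then show ?thesis
    using lipschitz_gradient_upper_bound[OF grad lip, of 0 d]
      strongly_convex_lower_bound[OF grad conv, of 0 d] by simp
qed

text \<open>\<open>F - \<mu>/2 |\<cdot>|\<^sup>2\<close> is convex and satisfies the quadratic upper bound with constant \<open>L - \<mu>\<close>:
  compare its tangent at \<open>x\<close> with the minimum over \<open>s\<close> of the upper bound at \<open>y + s\<close>. A constant
  \<open>l > 0\<close> above \<open>L - \<mu>\<close> covers the degenerate case \<open>L = \<mu>\<close>.\<close>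

lemma strongly_cocoercive_half:
  fixes F :: "'a::real_inner \<Rightarrow> real"
  assumes grad: "\<And>x. GDERIV F x :> G x" and lip: "L-lipschitz_on UNIV G"
    and conv: "strongly_convex \<mu> F" and l: "l > 0" "l \<ge> L - \<mu>"
    and b: "b = G y - G x - \<mu> *\<^sub>R (y - x)"
  shows "F x + G x \<bullet> (y - x) + \<mu> / 2 * (norm (y - x))\<^sup>2 + (norm b)\<^sup>2 / (2 * l) \<le> F y"
proof -
  define d where "d = y - x"
  define s where "s = - (1 / l) *\<^sub>R b"
  have "F x + G x \<bullet> (d + s) + \<mu> / 2 * (norm (d + s))\<^sup>2 \<le> F y + G y \<bullet> s + L / 2 * (norm s)\<^sup>2"
    using lipschitz_gradient_upper_bound[OF grad lip, of y s]
      strongly_convex_lower_bound[OF grad conv, of x "d + s"] by (simp add: d_def)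
  also have "\<dots> \<le> F y + G y \<bullet> s + (l + \<mu>) / 2 * (norm s)\<^sup>2"
    using l by (intro add_left_mono mult_right_mono) auto
  finally have "F x + G x \<bullet> d + \<mu> / 2 * (norm d)\<^sup>2 \<le> F y + b \<bullet> s + l / 2 * (norm s)\<^sup>2"
    unfolding b d_def[symmetric]
    by (simp add: power2_norm_eq_inner inner_commute algebra_simps add_divide_distrib)
  moreover have "b \<bullet> s + l / 2 * (norm s)\<^sup>2 = - ((norm b)\<^sup>2 / (2 * l))"
    using l unfolding s_def power2_norm_eq_inner by (simp add: field_simps)
  ultimately show ?thesis unfolding d_def by linarith
qed

text \<open>Adding the two half inequalities with x and y exchanged cancels the function values and
  leaves |b|^2 <= l (b . d). With b = c - \<mu> d and l = L - \<mu>, regrouping gives the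
  claim.\<close>

lemma strongly_cocoercive:
  fixes F :: "'a::euclidean_space \<Rightarrow> real"
  assumes grad: "\<And>x. GDERIV F x :> G x" and lip: "L-lipschitz_on UNIV G"
    and conv: "strongly_convex \<mu> F"
  shows "\<mu> * L * (norm (x - y))\<^sup>2 + (norm (G x - G y))\<^sup>2 \<le> (\<mu> + L) * ((G x - G y) \<bullet> (x - y))"
proof -
  define d where "d = x - y"
  define c where "c = G x - G y"
  define b where "b = c - \<mu> *\<^sub>R d"
  have le: "(norm b)\<^sup>2 \<le> l * (b \<bullet> d)" if l: "l > 0" "l \<ge> L - \<mu>" for l
  proof -
    have "norm (G y - G x - \<mu> *\<^sub>R (y - x)) = norm b"
      using norm_minus_cancel[of b] unfolding b_def c_def d_def by (simp add: algebra_simps)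
    moreover have "norm (y - x) = norm d" by (simp add: d_def norm_minus_commute)
    ultimately have "\<mu> * (norm d)\<^sup>2 + (norm b)\<^sup>2 / l \<le> c \<bullet> d"
      using strongly_cocoercive_half[OF grad lip conv l refl, of x y]
        strongly_cocoercive_half[OF grad lip conv l refl, of y x]
      by (simp add: b_def c_def d_def inner_diff_left inner_diff_right)
    then have "(norm b)\<^sup>2 / l \<le> b \<bullet> d"
      by (simp add: b_def inner_diff_left power2_norm_eq_inner)
    then show ?thesis using l by (simp add: field_simps)
  qed
  \<comment> \<open>L - \<mu> may be 0, which \<open>le\<close> excludes, so this value of l is
    reached as a limit from the right.\<close>
  have "(norm b)\<^sup>2 \<le> (L - \<mu>) * (b \<bullet> d)"
  proof (rule tendsto_lowerbound)
    show "((\<lambda>l. l * (b \<bullet> d)) \<longlongrightarrow> (L - \<mu>) * (b \<bullet> d)) (at_right (L - \<mu>))"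
      by (intro tendsto_intros)
    show "eventually (\<lambda>l. (norm b)\<^sup>2 \<le> l * (b \<bullet> d)) (at_right (L - \<mu>))"
      using strongly_convex_le_lipschitz[OF grad lip conv]
      by (intro eventually_mono[OF eventually_at_right_less] le) auto
  qed auto
  then show ?thesis
    unfolding b_def c_def[symmetric] d_def[symmetric]
    by (simp add: power2_norm_eq_inner inner_commute algebra_simps)
qed

text \<open>The bound on \<alpha> is what absorbs the quadratic term: cocoercivity contributes -2
  \<alpha> / (\<mu> + L) |c|^2, and this dominates \<alpha>^2 |c|^2.\<close>

lemma gradient_step_contraction:
  fixes F :: "'a::euclidean_space \<Rightarrow> real"
  assumes grad: "\<And>x. GDERIV F x :> G x" and lip: "L-lipschitz_on UNIV G"
    and conv: "strongly_convex \<mu> F" and \<alpha>: "0 \<le> \<alpha>" "\<alpha> \<le> 2 / (\<mu> + L)"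
  shows "(norm ((x - \<alpha> *\<^sub>R G x) - (y - \<alpha> *\<^sub>R G y)))\<^sup>2
    \<le> (1 - 2 * \<alpha> * (\<mu> * L / (\<mu> + L))) * (norm (x - y))\<^sup>2"
proof -
  define d where "d = x - y"
  define c where "c = G x - G y"
  have pos: "\<mu> + L > 0"
    using strongly_convex_le_lipschitz[OF grad lip conv] conv by (simp add: strongly_convex_def)
  have "(norm ((x - \<alpha> *\<^sub>R G x) - (y - \<alpha> *\<^sub>R G y)))\<^sup>2 = (norm (d - \<alpha> *\<^sub>R c))\<^sup>2"
    by (simp add: c_def d_def algebra_simps)
  also have "\<dots> = (norm d)\<^sup>2 - 2 * \<alpha> * (c \<bullet> d) + \<alpha> * \<alpha> * (norm c)\<^sup>2"
    by (simp add: power2_norm_eq_inner inner_commute algebra_simps)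
  also have "\<dots> \<le> (norm d)\<^sup>2 - 2 * \<alpha> * (c \<bullet> d) + \<alpha> * (2 / (\<mu> + L)) * (norm c)\<^sup>2"
    using \<alpha> by (intro add_left_mono mult_right_mono mult_left_mono) auto
  also have "\<dots> \<le> (norm d)\<^sup>2 - 2 * \<alpha> * ((\<mu> * L * (norm d)\<^sup>2 + (norm c)\<^sup>2) / (\<mu> + L))
      + \<alpha> * (2 / (\<mu> + L)) * (norm c)\<^sup>2"
    using strongly_cocoercive[OF grad lip conv, of x y] pos \<alpha>
    by (intro add_right_mono diff_left_mono mult_left_mono)
      (auto simp: c_def d_def divide_le_eq mult.commute)
  also have "\<dots> = (1 - 2 * \<alpha> * (\<mu> * L / (\<mu> + L))) * (norm d)\<^sup>2"
    by (simp add: algebra_simps add_divide_distrib)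
  finally show ?thesis by (simp add: d_def)
qed

text \<open>The contraction bounds a squared norm by this factor times |d|^2 = 1, which forces its
  sign. It yields \<nu> <= 1 and \<open>c1\<close> >= 0 later.\<close>

lemma gradient_step_factor_nonneg:
  fixes F :: "'a::euclidean_space \<Rightarrow> real"
  assumes grad: "\<And>x. GDERIV F x :> G x" and lip: "L-lipschitz_on UNIV G"
    and conv: "strongly_convex \<mu> F" and \<alpha>: "0 \<le> \<alpha>" "\<alpha> \<le> 2 / (\<mu> + L)"
  shows "0 \<le> 1 - 2 * \<alpha> * (\<mu> * L / (\<mu> + L))"
proof -
  obtain d :: 'a where "norm d = 1" using vector_choose_size[of 1] by auto
  have "0 \<le> (norm ((d - \<alpha> *\<^sub>R G d) - (0 - \<alpha> *\<^sub>R G 0)))\<^sup>2" by simp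
  also have "\<dots> \<le> (1 - 2 * \<alpha> * (\<mu> * L / (\<mu> + L))) * (norm (d - 0))\<^sup>2"
    by (rule gradient_step_contraction[OF assms])
  finally show ?thesis using \<open>norm d = 1\<close> by simp
qed

text \<open>\<open>argmin\<close> is a choice operator, so a minimizer has to be produced first. The
  gradient step is a contraction; its Banach fixed point z is a zero of \<open>G\<close>, and the
  strongly convex lower bound at z makes it the only minimizer.\<close>

lemma gradient_argmin_eq_0:
  fixes F :: "'a::euclidean_space \<Rightarrow> real"
  assumes grad: "\<And>x. GDERIV F x :> G x" and lip: "L-lipschitz_on UNIV G"
    and conv: "strongly_convex \<mu> F"
  shows "G (argmin F) = 0"
proof -
  have \<mu>: "\<mu> > 0" using conv by (simp add: strongly_convex_def)
  have L: "\<mu> \<le> L" by (rule strongly_convex_le_lipschitz[OF assms])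
  define \<alpha> where "\<alpha> = 2 / (\<mu> + L)"
  define q where "q = 1 - 2 * \<alpha> * (\<mu> * L / (\<mu> + L))"
  have \<alpha>: "\<alpha> > 0" using \<mu> L by (simp add: \<alpha>_def)
  have q: "0 \<le> q" unfolding q_def
    by (rule gradient_step_factor_nonneg[OF assms]) (use \<alpha> in \<open>auto simp: \<alpha>_def\<close>)
  have "q < 1" using \<alpha> \<mu> L by (simp add: q_def)
  \<comment> \<open>The contraction estimate concerns squared distances, hence the Lipschitz
    constant \<open>sqrt q\<close>.\<close>
  have "\<exists>!x. x - \<alpha> *\<^sub>R G x = x"
  proof (rule banach_fix_type, safe)
    fix x y
    have "(dist (x - \<alpha> *\<^sub>R G x) (y - \<alpha> *\<^sub>R G y))\<^sup>2 \<le> q * (dist x y)\<^sup>2"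
      unfolding dist_norm q_def
      by (rule gradient_step_contraction[OF assms]) (use \<alpha> in \<open>auto simp: \<alpha>_def\<close>)
    also have "\<dots> = (sqrt q * dist x y)\<^sup>2" using q by (simp add: power_mult_distrib)
    finally show "dist (x - \<alpha> *\<^sub>R G x) (y - \<alpha> *\<^sub>R G y) \<le> sqrt q * dist x y"
      by (rule power2_le_imp_le) (use q in auto)
  qed (use q \<open>q < 1\<close> in auto)
  then obtain z where z: "G z = 0" using \<alpha> by auto
  have "is_arg_min F (\<lambda>_. True) z"
    unfolding is_arg_min_linorder
  proof safe
    fix y show "F z \<le> F y"
      using strongly_convex_lower_bound[OF grad conv, of z "y - z"] z \<mu>
      by (simp add: add_increasing2 order_trans[rotated])
  qed
  then have "F (argmin F) \<le> F z"
    unfolding argmin_def arg_min_def by (rule someI2) (auto simp: is_arg_min_linorder)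
  moreover have "F z + \<mu> / 2 * (norm (argmin F - z))\<^sup>2 \<le> F (argmin F)"
    using strongly_convex_lower_bound[OF grad conv, of z "argmin F - z"] z by simp
  ultimately have "\<mu> / 2 * (norm (argmin F - z))\<^sup>2 \<le> 0" by linarith
  then have "argmin F = z" using \<mu> by (simp add: mult_le_0_iff)
  then show ?thesis using z by simp
qed

subsection \<open>Second singular value and consensus\<close>

lemma norm_sq_eq_sum: "(norm (v :: real^'n))\<^sup>2 = (\<Sum>i\<in>UNIV. (v $ i)\<^sup>2)"
  by (simp add: norm_vec_def L2_set_def sum_nonneg)

lemma transpose_mult_self_inner:
  fixes A :: "real^'n^'m"
  shows "((transpose A ** A) *v u) \<bullet> v = (A *v u) \<bullet> (A *v v)"
  by (simp add: matrix_vector_mul_assoc[symmetric] dot_lmul_matrix)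

lemma singular_mult_pos_iff:
  fixes A :: "real^'n^'m"
  shows "singular_mult A s > 0 \<longleftrightarrow> (\<exists>v. v \<noteq> 0 \<and> (transpose A ** A) *v v = s\<^sup>2 *\<^sub>R v)"
  unfolding singular_mult_def neq0_conv[symmetric] dim_eq_0 by auto

text \<open>\<open>singular_values\<close> sums over this set, and a sum over an infinite set would
  collapse to the empty multiset. Eigenvectors of the symmetric matrix
  \<open>transpose A ** A\<close> for different s >= 0 are orthogonal, hence independent, hence
  finitely many.\<close>

lemma finite_singular_values:
  fixes A :: "real^'n^'m"
  shows "finite {s. 0 \<le> s \<and> singular_mult A s > 0}"
proof -
  let ?S = "{s. 0 \<le> s \<and> singular_mult A s > 0}"
  have "\<forall>s\<in>?S. \<exists>v. v \<noteq> 0 \<and> (transpose A ** A) *v v = s\<^sup>2 *\<^sub>R v"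
    by (simp add: singular_mult_pos_iff)
  from bchoice[OF this] obtain v where
    v: "\<And>s. s \<in> ?S \<Longrightarrow> v s \<noteq> 0 \<and> (transpose A ** A) *v v s = s\<^sup>2 *\<^sub>R v s"
    by blast
  have orth: "v s \<bullet> v t = 0" if st: "s \<in> ?S" "t \<in> ?S" "s \<noteq> t" for s t
  proof -
    have "s\<^sup>2 * (v s \<bullet> v t) = ((transpose A ** A) *v v s) \<bullet> v t"
      using v st by simp
    also have "\<dots> = v s \<bullet> ((transpose A ** A) *v v t)"
      by (metis transpose_mult_self_inner inner_commute)
    also have "\<dots> = t\<^sup>2 * (v s \<bullet> v t)"
      using v st by simp
    finally have "v s \<bullet> v t = 0 \<or> s\<^sup>2 = t\<^sup>2" by simp
    then show ?thesis using st by (simp add: power2_eq_iff_nonneg)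
  qed
  have "inj_on v ?S"
    by (intro inj_onI) (use orth v in fastforce)
  moreover have "finite (v ` ?S)"
  proof (rule independent_imp_finite, rule pairwise_orthogonal_independent)
    show "pairwise orthogonal (v ` ?S)"
      unfolding pairwise_def orthogonal_def using orth by blast
    show "0 \<notin> v ` ?S" using v by auto
  qed
  ultimately show ?thesis by (rule finite_imageD[rotated])
qed

lemma count_singular_values:
  fixes A :: "real^'n^'m"
  shows "count (mset (singular_values A)) s = (if 0 \<le> s then singular_mult A s else 0)"
  unfolding singular_values_def
  using finite_singular_values[of A] by (auto simp: count_sum if_distrib sum.delta cong: if_cong)

lemma set_singular_values:
  fixes A :: "real^'n^'m"
  shows "set (singular_values A) = {s. 0 \<le> s \<and> singular_mult A s > 0}"
  unfolding set_mset_mset[symmetric] set_eq_iff count_greater_zero_iff[symmetric] count_singular_values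
  by auto

lemma sorted_singular_values: "sorted_wrt (\<ge>) (singular_values A)"
  by (simp add: singular_values_def sorted_wrt_rev)

text \<open>Only one of two distinct entries can be the head of the decreasing list; the second
  entry dominates the other.\<close>

lemma second_singular_value_ge:
  fixes A :: "real^'n^'n"
  assumes "singular_mult A a > 0" "singular_mult A b > 0" "a \<noteq> b" "0 \<le> m" "m \<le> a" "m \<le> b"
  shows "m \<le> second_singular_value A"
proof -
  have ab: "a \<in> set (singular_values A)" "b \<in> set (singular_values A)"
    using assms by (auto simp: set_singular_values)
  show ?thesis
  proof (cases "singular_values A")
    case (Cons x1 r)
    with ab \<open>a \<noteq> b\<close> obtain x2 r' where r: "r = x2 # r'" by (cases r) auto
    have "x1 \<ge> x2" "\<forall>z\<in>set r'. z \<le> x2"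
      using sorted_singular_values[of A] by (auto simp: Cons r)
    then have "m \<le> x2" using ab assms by (fastforce simp: Cons r)
    then show ?thesis by (simp add: second_singular_value_def Cons r)
  qed (use ab in auto)
qed

lemma second_singular_value_nonneg: "0 \<le> second_singular_value (A :: real^'n^'n)"
  using nth_mem[of 1 "singular_values A"]
  by (auto simp: second_singular_value_def set_singular_values)

text \<open>If the second entry were m, the first would be m too, against multiplicity at most one.
  For a list with fewer than two entries the conventional value 0 is compared with m.\<close>

lemma second_singular_value_less:
  fixes A :: "real^'n^'n"
  assumes "\<And>s. 0 \<le> s \<Longrightarrow> singular_mult A s > 0 \<Longrightarrow> s \<le> m" and "singular_mult A m \<le> 1" and "0 < m"
  shows "second_singular_value A < m"
proof (cases "length (singular_values A) \<ge> 2")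
  case True
  then obtain x1 x2 r where xs: "singular_values A = x1 # x2 # r"
    by (metis (no_types, lifting) One_nat_def Suc_1 Suc_le_length_iff)
  have "x2 \<le> x1" using sorted_singular_values[of A] by (auto simp: xs)
  have "x1 \<in> set (singular_values A)" "x2 \<in> set (singular_values A)" by (auto simp: xs)
  then have "x1 \<le> m" "x2 \<le> m" using assms(1) by (auto simp: set_singular_values)
  moreover have "x2 \<noteq> m"
  proof
    assume "x2 = m"
    with \<open>x2 \<le> x1\<close> \<open>x1 \<le> m\<close> have "count (mset (singular_values A)) m \<ge> 2" by (simp add: xs)
    then show False using assms by (simp add: count_singular_values)
  qed
  ultimately show ?thesis by (simp add: second_singular_value_def xs)
qed (use assms in \<open>simp add: second_singular_value_def\<close>)

section \<open>Consensus matrices of connected networks\<close>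

context
  fixes E :: "('n::finite \<times> 'n) set" and W :: "real^'n^'n"
  assumes net: "connected_network E" and cons: "consensus_matrix E W"
begin

lemma consensus_row_sum: "(\<Sum>j\<in>UNIV. W $ i $ j) = 1"
  and consensus_col_sum: "(\<Sum>i\<in>UNIV. W $ i $ j) = 1"
  and consensus_nonneg: "W $ i $ j \<ge> 0"
  and consensus_diag: "W $ i $ i > 0"
  and consensus_symmetric: "transpose W = W"
  using cons by (auto simp: consensus_matrix_def)

lemma consensus_edge: "(i, j) \<in> E \<Longrightarrow> W $ i $ j > 0"
  using cons net unfolding consensus_matrix_def connected_network_def irrefl_def by metis

text \<open>Row i of \<open>W\<close> is a probability vector, and the inner sum is the variance of
  v under it: mean of squares minus squared mean. Unit column sums turn the total of the mean
  squares into |v|^2. The exact identity gives both nonexpansiveness and its equality case.\<close>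

lemma consensus_energy_loss:
  "(norm v)\<^sup>2 - (norm (W *v v))\<^sup>2 = (\<Sum>i\<in>UNIV. \<Sum>j\<in>UNIV. W $ i $ j * (v $ j - (W *v v) $ i)\<^sup>2)"
proof -
  have "(\<Sum>j\<in>UNIV. W $ i $ j * (v $ j - (W *v v) $ i)\<^sup>2)
      = (\<Sum>j\<in>UNIV. W $ i $ j * (v $ j)\<^sup>2) - ((W *v v) $ i)\<^sup>2" for i
  proof -
    let ?w = "(W *v v) $ i"
    have "(\<Sum>j\<in>UNIV. W $ i $ j * (v $ j - ?w)\<^sup>2)
        = (\<Sum>j\<in>UNIV. W $ i $ j * (v $ j)\<^sup>2 - 2 * ?w * (W $ i $ j * v $ j) + ?w\<^sup>2 * W $ i $ j)"
      by (intro sum.cong) (auto simp: power2_eq_square algebra_simps)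
    also have "\<dots> = (\<Sum>j\<in>UNIV. W $ i $ j * (v $ j)\<^sup>2) - 2 * ?w * ?w + ?w\<^sup>2 * 1"
      by (simp only: sum.distrib sum_subtractf sum_distrib_left[symmetric] consensus_row_sum)
        (simp add: matrix_vector_mult_def)
    finally show ?thesis by (simp add: power2_eq_square)
  qed
  then have "(\<Sum>i\<in>UNIV. \<Sum>j\<in>UNIV. W $ i $ j * (v $ j - (W *v v) $ i)\<^sup>2)
      = (\<Sum>i\<in>UNIV. \<Sum>j\<in>UNIV. W $ i $ j * (v $ j)\<^sup>2) - (\<Sum>i\<in>UNIV. ((W *v v) $ i)\<^sup>2)"
    by (simp add: sum_subtractf)
  also have "(\<Sum>i\<in>UNIV. \<Sum>j\<in>UNIV. W $ i $ j * (v $ j)\<^sup>2) = (\<Sum>j\<in>UNIV. (v $ j)\<^sup>2)"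
    by (subst sum.swap) (simp add: sum_distrib_right[symmetric] consensus_col_sum)
  finally show ?thesis
    by (simp add: norm_sq_eq_sum)
qed

lemma norm_consensus_le: "norm (W *v v) \<le> norm v"
proof -
  have "0 \<le> (norm v)\<^sup>2 - (norm (W *v v))\<^sup>2"
    unfolding consensus_energy_loss by (intro sum_nonneg mult_nonneg_nonneg consensus_nonneg) auto
  then show ?thesis by simp
qed

text \<open>All row variances vanish, so v_j = (Wv)_i wherever w_ij > 0. The positive diagonal gives
  v_i = (Wv)_i, so v agrees across every edge, and connectivity spreads this to all agents.\<close>

lemma norm_consensus_eq_imp_constant:
  assumes "norm (W *v v) = norm v"
  shows "v $ i = v $ j"
proof -
  have nn: "0 \<le> W $ i $ j * (v $ j - (W *v v) $ i)\<^sup>2" for i j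
    by (intro mult_nonneg_nonneg consensus_nonneg) auto
  have "(\<Sum>i\<in>UNIV. \<Sum>j\<in>UNIV. W $ i $ j * (v $ j - (W *v v) $ i)\<^sup>2) = 0"
    using consensus_energy_loss[of v] assms by simp
  then have "(\<Sum>j\<in>UNIV. W $ i $ j * (v $ j - (W *v v) $ i)\<^sup>2) = 0" for i
    by (rule sum_nonneg_0[rotated 2]) (auto intro: sum_nonneg nn)
  then have "W $ i $ j * (v $ j - (W *v v) $ i)\<^sup>2 = 0" for i j
    by (rule sum_nonneg_0[rotated 2]) (auto intro: nn)
  then have eq: "v $ j = (W *v v) $ i" if "W $ i $ j > 0" for i j
    using that by (metis less_irrefl mult_eq_0_iff zero_eq_power2 right_minus_eq)
  have step: "v $ i = v $ j" if "(i, j) \<in> E" for i j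
    using eq[OF consensus_edge[OF that]] eq[OF consensus_diag[of i]] by simp
  have "(i, j) \<in> E\<^sup>*" using net by (simp add: connected_network_def)
  then show ?thesis by (induction rule: rtrancl_induct) (auto dest: step)
qed

lemma sum_consensus: "(\<Sum>i\<in>UNIV. (W *v v) $ i) = (\<Sum>i\<in>UNIV. v $ i)"
  unfolding matrix_vector_mult_def
  by (simp, subst sum.swap) (simp add: sum_distrib_right[symmetric] consensus_col_sum)

lemma consensus_const: "W *v vec c = vec c"
  by (simp add: vec_eq_iff matrix_vector_mult_def sum_distrib_right[symmetric] consensus_row_sum)

lemma consensus_eigenvector_norm:
  assumes "(transpose W ** W) *v v = s\<^sup>2 *\<^sub>R v" "0 \<le> s"
  shows "norm (W *v v) = s * norm v"
proof -
  have "(norm (W *v v))\<^sup>2 = (s * norm v)\<^sup>2"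
    unfolding power2_norm_eq_inner power_mult_distrib transpose_mult_self_inner[symmetric] assms by simp
  then show ?thesis using assms by (simp add: power2_eq_iff_nonneg)
qed

text \<open>Nonexpansiveness bounds all singular values by 1, and a singular vector for 1 keeps its
  norm, hence is constant: the value 1 has multiplicity at most one.\<close>

lemma second_singular_value_consensus_less_1: "second_singular_value W < 1"
proof (rule second_singular_value_less)
  fix s :: real assume s: "0 \<le> s" "singular_mult W s > 0"
  from s(2) obtain v where v: "v \<noteq> 0" "(transpose W ** W) *v v = s\<^sup>2 *\<^sub>R v"
    unfolding singular_mult_pos_iff by blast
  show "s \<le> 1"
    using consensus_eigenvector_norm[OF v(2) s(1)] norm_consensus_le[of v] v(1) by simp
next
  have "{v. (transpose W ** W) *v v = 1\<^sup>2 *\<^sub>R v} \<subseteq> span {vec 1}"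
  proof safe
    fix v assume "(transpose W ** W) *v v = 1\<^sup>2 *\<^sub>R v"
    then have "norm (W *v v) = norm v" 
      using consensus_eigenvector_norm[of v 1] by simp
    then have "v $ i = v $ undefined" for i by (rule norm_consensus_eq_imp_constant)
    then have "v = (v $ undefined) *\<^sub>R vec 1" unfolding vec_eq_iff by simp
    then show "v \<in> span {vec 1}" by (metis span_base span_scale singletonI)
  qed
  then have "dim {v. (transpose W ** W) *v v = 1\<^sup>2 *\<^sub>R v} \<le> card {vec 1 :: real^'n}"
    by (intro dim_le_card) auto
  then show "singular_mult W 1 \<le> 1" by (simp add: singular_mult_def)
qed simp

text \<open>On the hyperplane of vectors with zero sum, a maximizer of \<open>|Wv|\<close> on the unit sphere is a
  singular vector, whose singular value is distinct from the value 1 belonging to the constants.\<close>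

lemma norm_consensus_zero_sum_le:
  assumes "(\<Sum>i\<in>UNIV. v $ i) = 0"
  shows "norm (W *v v) \<le> second_singular_value W * norm v"
proof (cases "v = 0")
  case False
  define S where "S = sphere 0 1 \<inter> {v :: real^'n. (\<Sum>i\<in>UNIV. v $ i) = 0}"
  have scaled: "(1 / norm u) *\<^sub>R u \<in> S" if "(\<Sum>i\<in>UNIV. u $ i) = 0" "u \<noteq> 0" for u :: "real^'n"
    using that by (simp add: S_def sum_divide_distrib[symmetric])
  have "compact S" unfolding S_def
    by (intro compact_Int_closed closed_Collect_eq continuous_intros) auto
  moreover have "S \<noteq> {}" using scaled[OF assms False] by blast
  moreover have "continuous_on S (\<lambda>v. norm (W *v v))"
    by (intro continuous_intros linear_continuous_on linear_conv_bounded_linear[THEN iffD1]) auto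
  ultimately obtain w where w: "w \<in> S" and max: "\<And>u. u \<in> S \<Longrightarrow> norm (W *v u) \<le> norm (W *v w)"
    by (metis continuous_attains_sup)
  define m where "m = norm (W *v w)"
  have bound: "norm (W *v u) \<le> m * norm u" if "(\<Sum>i\<in>UNIV. u $ i) = 0" for u
  proof (cases "u = 0")
    case False
    then show ?thesis using max[OF scaled[OF that False]]
      by (simp add: m_def matrix_vector_mult_scaleR field_simps)
  qed simp
  have w1: "norm w = 1" "(\<Sum>i\<in>UNIV. w $ i) = 0" using w by (auto simp: S_def)
  define u where "u = (transpose W ** W) *v w"
  have u: "u = W *v (W *v w)"
    by (simp add: u_def consensus_symmetric matrix_vector_mul_assoc)
  \<comment> \<open>\<open>W\<close> preserves zero sums, so \<open>bound\<close> applies a second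
    time, to Ww.\<close>
  have "norm u \<le> m\<^sup>2"
    using bound[of "W *v w"] w1 by (simp add: u sum_consensus m_def power2_eq_square)
  then have "norm u * norm u \<le> m\<^sup>2 * m\<^sup>2" by (intro mult_mono) auto
  then have "u \<bullet> u \<le> m\<^sup>2 * m\<^sup>2" by (simp only: norm_eq_sqrt_inner real_sqrt_mult_self)
  moreover have "u \<bullet> w = m\<^sup>2"
    by (simp add: u_def transpose_mult_self_inner m_def power2_norm_eq_inner)
  moreover have "w \<bullet> w = 1" using w1 by (simp add: norm_eq_1)
  \<comment> \<open>The expansion is at most m^4 - 2 m^4 + m^4 = 0. This equality case of
    Cauchy-Schwarz makes w an eigenvector without Lagrange multipliers.\<close>
  ultimately have "(u - m\<^sup>2 *\<^sub>R w) \<bullet> (u - m\<^sup>2 *\<^sub>R w) \<le> 0"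
    by (simp add: inner_commute algebra_simps)
  then have eig: "(transpose W ** W) *v w = m\<^sup>2 *\<^sub>R w"
    by (metis inner_ge_zero inner_eq_zero_iff order_antisym right_minus_eq u_def)
  have "w \<noteq> 0" using w1 by auto
  \<comment> \<open>If m were 1, then w would be constant; a constant vector of zero sum is 0,
    against |w| = 1.\<close>
  have "m \<noteq> 1"
  proof
    assume "m = 1"
    then have "norm (W *v w) = norm w" by (simp add: m_def w1)
    then have const: "w $ i = w $ undefined" for i by (rule norm_consensus_eq_imp_constant)
    have "(\<Sum>i\<in>UNIV. w $ i) = (\<Sum>i\<in>(UNIV :: 'n set). w $ undefined)"
      by (rule sum.cong) (use const in auto)
    then have "w $ undefined = 0" using w1 by simp
    then have "w $ i = 0" for i by (subst const)
    then show False using \<open>w \<noteq> 0\<close> by (auto simp: vec_eq_iff)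
  qed
  moreover have "singular_mult W m > 0"
    unfolding singular_mult_pos_iff using eig \<open>w \<noteq> 0\<close> by blast
  moreover have "singular_mult W 1 > 0"
    unfolding singular_mult_pos_iff
  proof (intro exI[of _ "vec 1"] conjI)
    show "(transpose W ** W) *v vec 1 = 1\<^sup>2 *\<^sub>R vec 1"
      by (simp only: consensus_symmetric matrix_vector_mul_assoc[symmetric] consensus_const
          power_one scaleR_one)
  qed (simp add: vec_eq_iff)
  moreover have "m \<le> 1" using norm_consensus_le[of w] by (simp add: m_def w1)
  ultimately have "m \<le> second_singular_value W"
    by (intro second_singular_value_ge[of W m 1]) (auto simp: m_def)
  then show ?thesis using bound[OF assms] by (meson mult_right_mono norm_ge_zero order_trans)
qed simp

lemma sum_matpow_consensus: "(\<Sum>i\<in>UNIV. (matpow W k *v v) $ i) = (\<Sum>i\<in>UNIV. v $ i)"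
  by (induction k) (simp_all add: matrix_vector_mul_assoc[symmetric] sum_consensus)

lemma norm_matpow_consensus_le: "norm (matpow W k *v v) \<le> norm v"
  by (induction k)
    (auto simp: matrix_vector_mul_assoc[symmetric] intro: order_trans[OF norm_consensus_le])

lemma matpow_consensus_const: "matpow W k *v vec c = vec c"
  by (induction k) (simp_all add: matrix_vector_mul_assoc[symmetric] consensus_const)

lemma norm_matpow_consensus_zero_sum_le:
  assumes "(\<Sum>i\<in>UNIV. v $ i) = 0"
  shows "norm (matpow W k *v v) \<le> second_singular_value W ^ k * norm v"
proof (induction k)
  case (Suc k)
  have "norm (W *v (matpow W k *v v)) \<le> second_singular_value W * norm (matpow W k *v v)"
    by (rule norm_consensus_zero_sum_le) (simp add: sum_matpow_consensus assms)
  also have "\<dots> \<le> second_singular_value W * (second_singular_value W ^ k * norm v)"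
    by (intro mult_left_mono Suc second_singular_value_nonneg)
  finally show ?case by (simp add: matrix_vector_mul_assoc[symmetric] mult_ac)
qed simp

text \<open>Constants are fixed by \<open>W\<close>, so the difference is the power of
  \<open>W\<close> applied to the centered vector, which has zero sum and, by Pythagoras, norm at
  most |v|.\<close>

lemma norm_matpow_consensus_diff_mean_le:
  fixes v :: "real^'n"
  defines "m \<equiv> (\<Sum>i\<in>UNIV. v $ i) / real CARD('n)"
  shows "norm (matpow W k *v v - vec m) \<le> second_singular_value W ^ k * norm v"
proof -
  have sum: "(\<Sum>i\<in>UNIV. v $ i) = real CARD('n) * m" by (simp add: m_def)
  have "norm (matpow W k *v v - vec m) = norm (matpow W k *v (v - vec m))"
    by (simp add: matrix_vector_mult_diff_distrib matpow_consensus_const)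
  also have "\<dots> \<le> second_singular_value W ^ k * norm (v - vec m)"
    by (rule norm_matpow_consensus_zero_sum_le) (simp add: sum_subtractf sum)
  also have "\<dots> \<le> second_singular_value W ^ k * norm v"
  proof (intro mult_left_mono zero_le_power second_singular_value_nonneg)
    have "(norm v)\<^sup>2 - (norm (v - vec m))\<^sup>2 = 2 * m * (\<Sum>i\<in>UNIV. v $ i) - real CARD('n) * m\<^sup>2"
      unfolding norm_sq_eq_sum
      by (simp add: power2_diff sum.distrib sum_subtractf sum_distrib_left mult_ac)
    also have "\<dots> = real CARD('n) * m\<^sup>2" by (simp add: sum power2_eq_square)
    finally have "(norm v)\<^sup>2 - (norm (v - vec m))\<^sup>2 = real CARD('n) * m\<^sup>2" .
    moreover have "0 \<le> real CARD('n) * m\<^sup>2" by simp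
    ultimately have "(norm (v - vec m))\<^sup>2 \<le> (norm v)\<^sup>2" by linarith
    then show "norm (v - vec m) \<le> norm v" by (rule power2_le_imp_le) simp
  qed
  finally show ?thesis .
qed

end

section \<open>Lifting from \<open>W\<close> to its Kronecker product with the identity\<close>

definition slice :: "real^('n::finite \<times> 'p::finite) \<Rightarrow> 'p \<Rightarrow> real^'n" where
  "slice x q = (\<chi> i. x $ (i, q))"

lemma sum_UNIV_prod:
  "(\<Sum>c\<in>UNIV. h c) = (\<Sum>i\<in>UNIV. \<Sum>q\<in>UNIV. h (i, q))"
  unfolding UNIV_Times_UNIV[symmetric] sum.cartesian_product by (simp add: split_beta)

text \<open>The identity factor keeps the coordinates of the local variables apart, so each
  coordinate is mixed by \<open>W\<close> alone. Facts about \<open>W\<close> thus transfer slice by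
  slice, while gradient steps act block by block.\<close>

lemma slice_matpow_kron:
  fixes W :: "real^'n::finite^'n" and y :: "real^('n \<times> 'p::finite)"
  shows "slice (matpow (kron W (mat 1)) k *v y) q = matpow W k *v slice y q"
proof (induction k)
  case (Suc k)
  have step: "slice (kron W (mat 1) *v z) q = W *v slice z q" for z :: "real^('n \<times> 'p)"
  proof -
    have "(\<Sum>c\<in>UNIV. W $ i $ fst c * (if q = snd c then 1 else 0) * z $ c) = (\<Sum>j\<in>UNIV. W $ i $ j * z $ (j, q))" for i
    proof -
      have "(\<Sum>c\<in>UNIV. W $ i $ fst c * (if q = snd c then 1 else 0) * z $ c)
          = (\<Sum>j\<in>UNIV. \<Sum>r\<in>UNIV. W $ i $ j * (if q = r then 1 else 0) * z $ (j, r))"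
        by (subst sum_UNIV_prod) simp
      also have "\<dots> = (\<Sum>j\<in>UNIV. W $ i $ j * z $ (j, q))"
        by (intro sum.cong) (auto simp: if_distrib[of "\<lambda>t. _ * t"] if_distrib[of "\<lambda>t. t * _"] cong: if_cong)
      finally show ?thesis .
    qed
    then show ?thesis
      by (simp add: slice_def vec_eq_iff matrix_vector_mult_def kron_def mat_def)
  qed
  then show ?case by (simp add: matrix_vector_mul_assoc[symmetric] Suc)
qed simp

lemma norm_sq_eq_sum_slice:
  fixes y :: "real^('n::finite \<times> 'p::finite)"
  shows "(norm y)\<^sup>2 = (\<Sum>q\<in>UNIV. (norm (slice y q))\<^sup>2)"
proof -
  have "(\<Sum>c\<in>UNIV. (y $ c)\<^sup>2) = (\<Sum>i\<in>UNIV. \<Sum>q\<in>UNIV. (y $ (i, q))\<^sup>2)"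
    by (rule sum_UNIV_prod)
  also have "\<dots> = (\<Sum>q\<in>UNIV. \<Sum>i\<in>UNIV. (y $ (i, q))\<^sup>2)" by (rule sum.swap)
  finally show ?thesis by (simp add: norm_sq_eq_sum slice_def)
qed

lemma norm_sq_eq_sum_block:
  fixes y :: "real^('n::finite \<times> 'p::finite)"
  shows "(norm y)\<^sup>2 = (\<Sum>i\<in>UNIV. (norm (block y i))\<^sup>2)"
proof -
  have "(\<Sum>c\<in>UNIV. (y $ c)\<^sup>2) = (\<Sum>i\<in>UNIV. \<Sum>q\<in>UNIV. (y $ (i, q))\<^sup>2)"
    by (rule sum_UNIV_prod)
  then show ?thesis by (simp add: norm_sq_eq_sum block_def)
qed

lemma avg_nth:
  fixes y :: "real^('n::finite \<times> 'p::finite)"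
  shows "avg y $ q = (\<Sum>i\<in>UNIV. slice y q $ i) / real CARD('n)"
  by (simp add: avg_def block_def slice_def sum_component)

lemma avg_consensus:
  fixes y :: "real^('n::finite \<times> 'p::finite)"
  assumes "connected_network E" "consensus_matrix E W"
  shows "avg (matpow (kron W (mat 1)) k *v y) = avg y"
  unfolding vec_eq_iff avg_nth slice_matpow_kron sum_matpow_consensus[OF assms] by blast

lemma norm_kron_consensus_le:
  fixes y :: "real^('n::finite \<times> 'p::finite)"
  assumes "connected_network E" "consensus_matrix E W"
  shows "norm (matpow (kron W (mat 1)) k *v y) \<le> norm y"
proof (rule power2_le_imp_le)
  show "(norm (matpow (kron W (mat 1)) k *v y))\<^sup>2 \<le> (norm y)\<^sup>2"
    unfolding norm_sq_eq_sum_slice slice_matpow_kron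
    by (intro sum_mono power_mono norm_matpow_consensus_le[OF assms]) auto
qed simp

lemma consensus_disagreement_le:
  fixes y :: "real^('n::finite \<times> 'p::finite)"
  assumes "connected_network E" "consensus_matrix E W"
  shows "(\<Sum>i\<in>UNIV. (norm (block (matpow (kron W (mat 1)) k *v y) i - avg y))\<^sup>2)
    \<le> (second_singular_value W ^ k)\<^sup>2 * (norm y)\<^sup>2"
proof -
  let ?x = "matpow (kron W (mat 1)) k *v y"
  have "(\<Sum>i\<in>UNIV. (norm (block ?x i - avg y))\<^sup>2) = (\<Sum>i\<in>UNIV. \<Sum>q\<in>UNIV. (slice ?x q $ i - avg y $ q)\<^sup>2)"
    by (simp add: norm_sq_eq_sum slice_def block_def)
  also have "\<dots> = (\<Sum>q\<in>UNIV. \<Sum>i\<in>UNIV. (slice ?x q $ i - avg y $ q)\<^sup>2)"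
    by (rule sum.swap)
  also have "\<dots> = (\<Sum>q\<in>UNIV. (norm (matpow W k *v slice y q - vec (avg y $ q)))\<^sup>2)"
    by (simp add: norm_sq_eq_sum slice_matpow_kron)
  also have "\<dots> \<le> (\<Sum>q\<in>UNIV. (second_singular_value W ^ k * norm (slice y q))\<^sup>2)"
    unfolding avg_nth by (intro sum_mono power_mono norm_matpow_consensus_diff_mean_le[OF assms]) auto
  also have "\<dots> = (second_singular_value W ^ k)\<^sup>2 * (norm y)\<^sup>2"
    by (simp add: power_mult_distrib sum_distrib_left norm_sq_eq_sum_slice)
  finally show ?thesis .
qed

subsection \<open>Fresh samples and stochastic gradients\<close>

text \<open>Young's inequality, from |t a - b|^2 / t >= 0. It is used with t = \<nu> for the mixing
  offset, t = \<psi> for the disagreement, and t = 1.\<close>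

lemma norm_add_sq_le:
  fixes a b :: "'a::real_inner"
  assumes "0 < t"
  shows "(norm (a + b))\<^sup>2 \<le> (1 + t) * (norm a)\<^sup>2 + (1 + inverse t) * (norm b)\<^sup>2"
proof -
  have "0 \<le> inverse t * (norm (t *\<^sub>R a - b))\<^sup>2" using assms by simp
  also have "\<dots> = t * (norm a)\<^sup>2 - 2 * (a \<bullet> b) + inverse t * (norm b)\<^sup>2"
    using assms unfolding power2_norm_eq_inner
    by (simp add: inner_diff_left inner_diff_right inner_commute field_simps)
  finally show ?thesis
    unfolding power2_norm_eq_inner by (simp add: inner_add_left inner_add_right inner_commute algebra_simps)
qed

lemma integrable_norm_sq_add:
  fixes a b :: "'w \<Rightarrow> 'e::euclidean_space"
  assumes [measurable]: "a \<in> borel_measurable M" "b \<in> borel_measurable M"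
    and "integrable M (\<lambda>\<omega>. (norm (a \<omega>))\<^sup>2)" "integrable M (\<lambda>\<omega>. (norm (b \<omega>))\<^sup>2)"
  shows "integrable M (\<lambda>\<omega>. (norm (a \<omega> + b \<omega>))\<^sup>2)"
proof (rule Bochner_Integration.integrable_bound)
  show "integrable M (\<lambda>\<omega>. 2 * (norm (a \<omega>))\<^sup>2 + 2 * (norm (b \<omega>))\<^sup>2)"
    using assms by simp
  show "AE \<omega> in M. norm ((norm (a \<omega> + b \<omega>))\<^sup>2) \<le> norm (2 * (norm (a \<omega>))\<^sup>2 + 2 * (norm (b \<omega>))\<^sup>2)"
    using norm_add_sq_le[of 1 "a _" "b _"] by (intro AE_I2) simp
qed measurable

lemma integrable_norm_sq_add_sum:
  fixes a :: "'w \<Rightarrow> 'e::euclidean_space" and b :: "'i \<Rightarrow> 'w \<Rightarrow> 'e"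
  assumes "finite I" and a: "a \<in> borel_measurable M" "integrable M (\<lambda>\<omega>. (norm (a \<omega>))\<^sup>2)"
    and b: "\<And>i. i \<in> I \<Longrightarrow> b i \<in> borel_measurable M" "\<And>i. i \<in> I \<Longrightarrow> integrable M (\<lambda>\<omega>. (norm (b i \<omega>))\<^sup>2)"
  shows "integrable M (\<lambda>\<omega>. (norm (a \<omega> + (\<Sum>i\<in>I. b i \<omega>)))\<^sup>2)"
  using \<open>finite I\<close> b
proof (induction I)
  case (insert i I)
  have "integrable M (\<lambda>\<omega>. (norm (b i \<omega> + (a \<omega> + (\<Sum>i\<in>I. b i \<omega>))))\<^sup>2)"
    by (rule integrable_norm_sq_add) (use insert a in \<open>auto intro!: borel_measurable_add borel_measurable_sum\<close>)
  then show ?case using insert by (simp add: add.left_commute)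
qed (use a in simp)

section \<open>Averaging over fresh samples with the iterate frozen\<close>

context prob_space
begin

lemma fresh_samples_measurable:
  assumes "fresh_samples M X \<xi>"
  shows "\<xi> i \<in> borel_measurable M"
  using assms by (simp add: fresh_samples_def indep_vars_def)

lemma fresh_samples_measurable_PiM:
  assumes "fresh_samples M X \<xi>"
  shows "(\<lambda>\<omega> i. \<xi> i \<omega>) \<in> measurable M (PiM UNIV (\<lambda>_. borel))"
  using fresh_samples_measurable[OF assms] by (intro measurable_PiM_single') auto

text \<open>Independence of the generated sigma-algebras fixes the joint law on rectangles, which
  determine it; a product law is the form that Fubini needs.\<close>

lemma fresh_samples_joint_distr:
  assumes fresh: "fresh_samples M X \<xi>" and X: "X \<in> borel_measurable M"
  shows "distr M (borel \<Otimes>\<^sub>M PiM UNIV (\<lambda>_. borel)) (\<lambda>\<omega>. (X \<omega>, \<lambda>i. \<xi> i \<omega>))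
    = distr M borel X \<Otimes>\<^sub>M distr M (PiM UNIV (\<lambda>_. borel)) (\<lambda>\<omega> i. \<xi> i \<omega>)"
proof (rule pair_measure_eqI[symmetric])
  note \<xi> = fresh_samples_measurable_PiM[OF fresh]
  show "sigma_finite_measure (distr M borel X)"
    "sigma_finite_measure (distr M (PiM UNIV (\<lambda>_. borel)) (\<lambda>\<omega> i. \<xi> i \<omega>))"
    using X \<xi> by (auto intro!: prob_space_imp_sigma_finite prob_space_distr)
  fix A B assume A: "A \<in> sets (distr M borel X)"
    and B: "B \<in> sets (distr M (PiM UNIV (\<lambda>_. borel)) (\<lambda>\<omega> i. \<xi> i \<omega>))"
  let ?A = "X -` A \<inter> space M" and ?B = "(\<lambda>\<omega> i. \<xi> i \<omega>) -` B \<inter> space M"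
  have "prob (?A \<inter> ?B) = prob ?A * prob ?B"
    by (rule indep_setD[OF fresh[unfolded fresh_samples_def, THEN conjunct2]])
      (use A B in \<open>auto simp: gen_alg_def intro: in_vimage_algebra\<close>)
  moreover have "(\<lambda>\<omega>. (X \<omega>, \<lambda>i. \<xi> i \<omega>)) -` (A \<times> B) \<inter> space M = ?A \<inter> ?B" by auto
  ultimately show "emeasure (distr M borel X) A * emeasure (distr M (PiM UNIV (\<lambda>_. borel)) (\<lambda>\<omega> i. \<xi> i \<omega>)) B
      = emeasure (distr M (borel \<Otimes>\<^sub>M PiM UNIV (\<lambda>_. borel)) (\<lambda>\<omega>. (X \<omega>, \<lambda>i. \<xi> i \<omega>))) (A \<times> B)"
    using A B X \<xi>
    by (simp add: emeasure_distr emeasure_eq_measure ennreal_mult[symmetric])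
qed simp

text \<open>Fubini for the product law, pulled back to \<open>M\<close>: the inner integral averages
  the samples while the iterate stays fixed. This replaces conditioning on the whole
  iterate.\<close>

lemma
  fixes F :: "'x::euclidean_space \<times> ('n \<Rightarrow> 'd::euclidean_space) \<Rightarrow> 'e::euclidean_space"
  assumes fresh: "fresh_samples M X \<xi>" and X[measurable]: "X \<in> borel_measurable M"
    and F[measurable]: "F \<in> borel_measurable (borel \<Otimes>\<^sub>M PiM UNIV (\<lambda>_. borel))"
    and int: "integrable M (\<lambda>\<omega>. F (X \<omega>, \<lambda>i. \<xi> i \<omega>))"
  shows fresh_samples_AE_integrable: "AE \<omega> in M. integrable M (\<lambda>\<omega>'. F (X \<omega>, \<lambda>i. \<xi> i \<omega>'))"
    and fresh_samples_integrable: "integrable M (\<lambda>\<omega>. \<integral>\<omega>'. F (X \<omega>, \<lambda>i. \<xi> i \<omega>') \<partial>M)"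
    and fresh_samples_integral:
      "(\<integral>\<omega>. F (X \<omega>, \<lambda>i. \<xi> i \<omega>) \<partial>M) = (\<integral>\<omega>. (\<integral>\<omega>'. F (X \<omega>, \<lambda>i. \<xi> i \<omega>') \<partial>M) \<partial>M)"
proof -
  note \<xi>[measurable] = fresh_samples_measurable_PiM[OF fresh]
  let ?P = "PiM UNIV (\<lambda>_. borel) :: ('n \<Rightarrow> 'd) measure"
  let ?PX = "distr M borel X" and ?P\<xi> = "distr M ?P (\<lambda>\<omega> i. \<xi> i \<omega>)"
  interpret PX: prob_space ?PX by (rule prob_space_distr) measurable
  interpret P\<xi>: prob_space ?P\<xi> by (rule prob_space_distr) measurable
  interpret pair_sigma_finite ?PX ?P\<xi> ..
  have joint: "distr M (borel \<Otimes>\<^sub>M ?P) (\<lambda>\<omega>. (X \<omega>, \<lambda>i. \<xi> i \<omega>)) = ?PX \<Otimes>\<^sub>M ?P\<xi>"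
    by (rule fresh_samples_joint_distr[OF fresh X])
  have pair[measurable]: "(\<lambda>\<omega>. (X \<omega>, \<lambda>i. \<xi> i \<omega>)) \<in> measurable M (borel \<Otimes>\<^sub>M ?P)" by measurable
  have Fx: "(\<lambda>z. F (x, z)) \<in> borel_measurable ?P" for x by measurable
  have int': "integrable (?PX \<Otimes>\<^sub>M ?P\<xi>) F"
    unfolding joint[symmetric] using int by (simp add: integrable_distr_eq)
  have inner: "(\<integral>z. F (x, z) \<partial>?P\<xi>) = (\<integral>\<omega>'. F (x, \<lambda>i. \<xi> i \<omega>') \<partial>M)" for x
    by (rule integral_distr[OF \<xi> Fx])
  have "AE x in ?PX. integrable ?P\<xi> (\<lambda>z. F (x, z))" by (rule AE_integrable_fst'[OF int'])
  from AE_distrD[OF X this] show "AE \<omega> in M. integrable M (\<lambda>\<omega>'. F (X \<omega>, \<lambda>i. \<xi> i \<omega>'))"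
    by (simp add: integrable_distr_eq[OF \<xi> Fx])
  have m: "(\<lambda>x. \<integral>z. F (x, z) \<partial>?P\<xi>) \<in> borel_measurable borel"
    using integrable_fst'[OF int'] by (simp add: borel_measurable_integrable measurable_distr_eq1)
  show "integrable M (\<lambda>\<omega>. \<integral>\<omega>'. F (X \<omega>, \<lambda>i. \<xi> i \<omega>') \<partial>M)"
    by (rule integrable_distr[OF X integrable_fst'[OF int', unfolded inner]])
  have "(\<integral>\<omega>. F (X \<omega>, \<lambda>i. \<xi> i \<omega>) \<partial>M) = integral\<^sup>L (?PX \<Otimes>\<^sub>M ?P\<xi>) F"
    unfolding joint[symmetric] by (rule integral_distr[symmetric]) measurable
  also have "\<dots> = (\<integral>x. (\<integral>z. F (x, z) \<partial>?P\<xi>) \<partial>?PX)"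
    by (rule integral_fst'[OF int', symmetric])
  also have "\<dots> = (\<integral>\<omega>. (\<integral>\<omega>'. F (X \<omega>, \<lambda>i. \<xi> i \<omega>') \<partial>M) \<partial>M)"
    using integral_distr[OF X m] by (simp add: inner)
  finally show "(\<integral>\<omega>. F (X \<omega>, \<lambda>i. \<xi> i \<omega>) \<partial>M) = (\<integral>\<omega>. (\<integral>\<omega>'. F (X \<omega>, \<lambda>i. \<xi> i \<omega>') \<partial>M) \<partial>M)" .
qed

text \<open>Expectations of products factor for real variables, so the inner product is expanded
  over the basis.\<close>

lemma indep_centered_inner:
  fixes e :: "'i \<Rightarrow> 'a \<Rightarrow> 'e::euclidean_space"
  assumes indep: "indep_vars (\<lambda>_. borel) e I" and ij: "i \<in> I" "j \<in> I" "i \<noteq> j"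
    and int: "\<And>i. i \<in> I \<Longrightarrow> integrable M (e i)" and zero: "\<And>i. i \<in> I \<Longrightarrow> expectation (e i) = 0"
  shows "integrable M (\<lambda>\<omega>. e i \<omega> \<bullet> e j \<omega>)" "expectation (\<lambda>\<omega>. e i \<omega> \<bullet> e j \<omega>) = 0"
proof -
  have comp: "integrable M (\<lambda>\<omega>. (e i \<omega> \<bullet> b) * (e j \<omega> \<bullet> b)) \<and>
      expectation (\<lambda>\<omega>. (e i \<omega> \<bullet> b) * (e j \<omega> \<bullet> b)) = 0" for b
  proof -
    have ind: "indep_vars (\<lambda>_. borel) (\<lambda>k \<omega>. e k \<omega> \<bullet> b) {i, j}"
      by (rule indep_vars_compose2[OF indep_vars_subset[OF indep]]) (use ij in auto)
    have int2: "integrable M (\<lambda>\<omega>. e k \<omega> \<bullet> b)" if "k \<in> {i, j}" for k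
      using that ij int by auto
    have "expectation (\<lambda>\<omega>. e i \<omega> \<bullet> b) = 0"
      using int[of i] zero[of i] ij by simp
    then show ?thesis
      using indep_vars_integrable[OF _ ind int2] indep_vars_lebesgue_integral[OF _ ind int2] ij by simp
  qed
  have eq: "(\<lambda>\<omega>. e i \<omega> \<bullet> e j \<omega>) = (\<lambda>\<omega>. \<Sum>b\<in>Basis. (e i \<omega> \<bullet> b) * (e j \<omega> \<bullet> b))"
    by (intro ext euclidean_inner)
  show "integrable M (\<lambda>\<omega>. e i \<omega> \<bullet> e j \<omega>)" "expectation (\<lambda>\<omega>. e i \<omega> \<bullet> e j \<omega>) = 0"
    unfolding eq using comp by (simp_all add: Bochner_Integration.integral_sum)
qed

lemma expectation_norm_sq_add_indep_centered:
  fixes e :: "'i \<Rightarrow> 'a \<Rightarrow> 'e::euclidean_space"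
  assumes "finite I" and indep: "indep_vars (\<lambda>_. borel) e I"
    and int: "\<And>i. i \<in> I \<Longrightarrow> integrable M (e i)" and zero: "\<And>i. i \<in> I \<Longrightarrow> expectation (e i) = 0"
    and sq: "\<And>i. i \<in> I \<Longrightarrow> integrable M (\<lambda>\<omega>. (norm (e i \<omega>))\<^sup>2)"
  shows "expectation (\<lambda>\<omega>. (norm (v + (\<Sum>i\<in>I. e i \<omega>)))\<^sup>2)
    = (norm v)\<^sup>2 + (\<Sum>i\<in>I. expectation (\<lambda>\<omega>. (norm (e i \<omega>))\<^sup>2))"
proof -
  have pair: "integrable M (\<lambda>\<omega>. e i \<omega> \<bullet> e j \<omega>) \<and>
      expectation (\<lambda>\<omega>. e i \<omega> \<bullet> e j \<omega>) = (if j = i then expectation (\<lambda>\<omega>. (norm (e i \<omega>))\<^sup>2) else 0)"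
    if "i \<in> I" "j \<in> I" for i j
    using that indep_centered_inner[OF indep that _ int zero] sq[of i]
    by (cases "i = j") (auto simp: power2_norm_eq_inner)
  have "(norm (v + (\<Sum>i\<in>I. e i \<omega>)))\<^sup>2
      = (norm v)\<^sup>2 + 2 * (\<Sum>i\<in>I. v \<bullet> e i \<omega>) + (\<Sum>i\<in>I. \<Sum>j\<in>I. e i \<omega> \<bullet> e j \<omega>)" for \<omega>
  proof -
    have "(norm (v + s))\<^sup>2 = (norm v)\<^sup>2 + 2 * (v \<bullet> s) + s \<bullet> s" for s
      unfolding power2_norm_eq_inner by (simp add: inner_add_left inner_add_right inner_commute)
    from this[of "\<Sum>i\<in>I. e i \<omega>"] show ?thesis
      unfolding inner_sum_left unfolding inner_sum_right .
  qed
  then have "expectation (\<lambda>\<omega>. (norm (v + (\<Sum>i\<in>I. e i \<omega>)))\<^sup>2)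
      = (norm v)\<^sup>2 + 2 * (\<Sum>i\<in>I. v \<bullet> expectation (e i)) + (\<Sum>i\<in>I. \<Sum>j\<in>I. expectation (\<lambda>\<omega>. e i \<omega> \<bullet> e j \<omega>))"
    using int pair by (simp add: Bochner_Integration.integral_sum prob_space)
  then show ?thesis
    using zero pair \<open>finite I\<close> by (simp add: sum.delta)
qed

text \<open>For a frozen iterate v(X) is a constant and the e_i are independent and centered, so all
  cross terms vanish; integrating over the iterate then gives the sum of second moments.\<close>

lemma fresh_samples_norm_sq:
  fixes e :: "'n::finite \<Rightarrow> 'x::euclidean_space \<Rightarrow> 'd::euclidean_space \<Rightarrow> 'e::euclidean_space"
  assumes fresh: "fresh_samples M X \<xi>" and X[measurable]: "X \<in> borel_measurable M"
    and e[measurable]: "\<And>i. (\<lambda>(x, z). e i x z) \<in> borel_measurable (borel \<Otimes>\<^sub>M borel)"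
    and v[measurable]: "v \<in> borel_measurable borel"
    and centered: "\<And>i. AE \<omega> in M. integrable M (\<lambda>\<omega>'. e i (X \<omega>) (\<xi> i \<omega>'))
        \<and> expectation (\<lambda>\<omega>'. e i (X \<omega>) (\<xi> i \<omega>')) = 0"
    and sq: "\<And>i. integrable M (\<lambda>\<omega>. (norm (e i (X \<omega>) (\<xi> i \<omega>)))\<^sup>2)"
    and vsq: "integrable M (\<lambda>\<omega>. (norm (v (X \<omega>)))\<^sup>2)"
  shows "integrable M (\<lambda>\<omega>. (norm (v (X \<omega>) + (\<Sum>i\<in>I. e i (X \<omega>) (\<xi> i \<omega>))))\<^sup>2)"
    and "expectation (\<lambda>\<omega>. (norm (v (X \<omega>) + (\<Sum>i\<in>I. e i (X \<omega>) (\<xi> i \<omega>))))\<^sup>2)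
      = expectation (\<lambda>\<omega>. (norm (v (X \<omega>)))\<^sup>2) + (\<Sum>i\<in>I. expectation (\<lambda>\<omega>. (norm (e i (X \<omega>) (\<xi> i \<omega>)))\<^sup>2))"
proof -
  note \<xi>[measurable] = fresh_samples_measurable[OF fresh]
  have eX[measurable]: "(\<lambda>\<omega>. e i (X \<omega>) (\<xi> i \<omega>)) \<in> borel_measurable M" for i
    using measurable_compose[OF _ e[of i], of "\<lambda>\<omega>. (X \<omega>, \<xi> i \<omega>)" M] by simp
  have ex[measurable]: "e i x \<in> borel_measurable borel" for i x
    using measurable_compose[OF _ e[of i], of "\<lambda>z. (x, z)" borel] by simp
  have eP[measurable]: "(\<lambda>p. e i (fst p) (snd p i)) \<in> borel_measurable (borel \<Otimes>\<^sub>M PiM UNIV (\<lambda>_. borel))" for i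
    using measurable_compose[OF _ e[of i], of "\<lambda>p. (fst p, snd p i)" "borel \<Otimes>\<^sub>M PiM UNIV (\<lambda>_. borel)"] by simp
  show int: "integrable M (\<lambda>\<omega>. (norm (v (X \<omega>) + (\<Sum>i\<in>I. e i (X \<omega>) (\<xi> i \<omega>))))\<^sup>2)"
    by (rule integrable_norm_sq_add_sum[OF _ _ vsq _ sq]) auto
  have indep: "indep_vars (\<lambda>_. borel) (\<lambda>i \<omega>. e i x (\<xi> i \<omega>)) I" for x
    by (rule indep_vars_compose2[OF indep_vars_subset[OF fresh[unfolded fresh_samples_def, THEN conjunct1]]]) auto
  define F where "F p = (norm (v (fst p) + (\<Sum>i\<in>I. e i (fst p) (snd p i))))\<^sup>2" for p
  define Fe where "Fe i p = (norm (e i (fst p) (snd p i)))\<^sup>2" for i p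
  have F: "F \<in> borel_measurable (borel \<Otimes>\<^sub>M PiM UNIV (\<lambda>_. borel))" unfolding F_def by measurable
  have Fe: "Fe i \<in> borel_measurable (borel \<Otimes>\<^sub>M PiM UNIV (\<lambda>_. borel))" for i unfolding Fe_def by measurable
  note dec = fresh_samples_integral[OF fresh X F, unfolded F_def fst_conv snd_conv, OF int]
  note dec_e = fresh_samples_AE_integrable[OF fresh X Fe, unfolded Fe_def fst_conv snd_conv, OF sq]
    fresh_samples_integrable[OF fresh X Fe, unfolded Fe_def fst_conv snd_conv, OF sq]
    fresh_samples_integral[OF fresh X Fe, unfolded Fe_def fst_conv snd_conv, OF sq]
  \<comment> \<open>Finitely many agents, so one null set serves all of them.\<close>
  have "AE \<omega> in M. \<forall>i. integrable M (\<lambda>\<omega>'. e i (X \<omega>) (\<xi> i \<omega>'))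
        \<and> expectation (\<lambda>\<omega>'. e i (X \<omega>) (\<xi> i \<omega>')) = 0 \<and> integrable M (\<lambda>\<omega>'. (norm (e i (X \<omega>) (\<xi> i \<omega>')))\<^sup>2)"
    using centered dec_e(1) by (simp add: AE_all_countable)
  then have inner: "AE \<omega> in M. expectation (\<lambda>\<omega>'. (norm (v (X \<omega>) + (\<Sum>i\<in>I. e i (X \<omega>) (\<xi> i \<omega>'))))\<^sup>2)
      = (norm (v (X \<omega>)))\<^sup>2 + (\<Sum>i\<in>I. expectation (\<lambda>\<omega>'. (norm (e i (X \<omega>) (\<xi> i \<omega>')))\<^sup>2))"
  proof eventually_elim
    case (elim \<omega>)
    then show ?case by (intro expectation_norm_sq_add_indep_centered[OF _ indep]) auto
  qed
  have "expectation (\<lambda>\<omega>. (norm (v (X \<omega>) + (\<Sum>i\<in>I. e i (X \<omega>) (\<xi> i \<omega>))))\<^sup>2)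
      = expectation (\<lambda>\<omega>. (norm (v (X \<omega>)))\<^sup>2 + (\<Sum>i\<in>I. expectation (\<lambda>\<omega>'. (norm (e i (X \<omega>) (\<xi> i \<omega>')))\<^sup>2)))"
    unfolding dec
  proof (rule integral_cong_AE)
    show "(\<lambda>\<omega>. expectation (\<lambda>\<omega>'. (norm (v (X \<omega>) + (\<Sum>i\<in>I. e i (X \<omega>) (\<xi> i \<omega>'))))\<^sup>2)) \<in> borel_measurable M"
      using fresh_samples_integrable[OF fresh X F, unfolded F_def fst_conv snd_conv, OF int] by (rule borel_measurable_integrable)
  qed (use inner vsq dec_e(2) in auto)
  also have "\<dots> = expectation (\<lambda>\<omega>. (norm (v (X \<omega>)))\<^sup>2) + (\<Sum>i\<in>I. expectation (\<lambda>\<omega>. (norm (e i (X \<omega>) (\<xi> i \<omega>)))\<^sup>2))"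
    using vsq dec_e(2) by (simp add: Bochner_Integration.integral_sum dec_e(3))
  finally show "expectation (\<lambda>\<omega>. (norm (v (X \<omega>) + (\<Sum>i\<in>I. e i (X \<omega>) (\<xi> i \<omega>))))\<^sup>2)
      = expectation (\<lambda>\<omega>. (norm (v (X \<omega>)))\<^sup>2) + (\<Sum>i\<in>I. expectation (\<lambda>\<omega>. (norm (e i (X \<omega>) (\<xi> i \<omega>)))\<^sup>2))" .
qed

lemma gen_alg_subalgebra:
  assumes "Y \<in> measurable M N"
  shows "finite_measure_subalgebra M (gen_alg M N Y)"
proof
  show "subalgebra M (gen_alg M N Y)"
    unfolding subalgebra_def gen_alg_def using measurable_sets[OF assms] measurable_space[OF assms]
    by (auto simp: sets_vimage_algebra2)
qed

text \<open>Integrating the conditional bound against the test function 1 removes the conditioning.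
  Working with nonnegative integrals lets square integrability come out as a consequence.\<close>

lemma stochastic_gradient_variance:
  fixes G :: "'a \<Rightarrow> real^'p"
  assumes sg: "stochastic_gradient M \<sigma> f Y G" and [measurable]: "Y \<in> borel_measurable M"
    and [measurable]: "grad f \<in> borel_measurable borel"
  shows "integrable M (\<lambda>\<omega>. (norm (G \<omega> - grad f (Y \<omega>)))\<^sup>2)"
    and "expectation (\<lambda>\<omega>. (norm (G \<omega> - grad f (Y \<omega>)))\<^sup>2) \<le> \<sigma>\<^sup>2"
proof -
  interpret finite_measure_subalgebra M "gen_alg M borel Y" by (rule gen_alg_subalgebra) fact
  let ?q = "\<lambda>\<omega>. (norm (G \<omega> - grad f (Y \<omega>)))\<^sup>2"
  have [measurable]: "G \<in> borel_measurable M"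
    using sg by (simp add: stochastic_gradient_def borel_measurable_integrable)
  have "(\<integral>\<^sup>+\<omega>. ennreal (?q \<omega>) \<partial>M) = (\<integral>\<^sup>+\<omega>. nn_cond_exp M (gen_alg M borel Y) (\<lambda>\<omega>. ennreal (?q \<omega>)) \<omega> \<partial>M)"
    using nn_cond_exp_intg[of "\<lambda>_. 1" "\<lambda>\<omega>. ennreal (?q \<omega>)"] by simp
  also have "\<dots> \<le> (\<integral>\<^sup>+\<omega>. ennreal (\<sigma>\<^sup>2) \<partial>M)"
    using sg by (intro nn_integral_mono_AE) (simp add: stochastic_gradient_def)
  finally have le: "(\<integral>\<^sup>+\<omega>. ennreal (?q \<omega>) \<partial>M) \<le> ennreal (\<sigma>\<^sup>2)" by (simp add: emeasure_space_1)
  show "integrable M ?q"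
    using le by (intro integrableI_nonneg) (auto intro: le_less_trans)
  then have "ennreal (expectation ?q) \<le> ennreal (\<sigma>\<^sup>2)"
    using le by (simp add: nn_integral_eq_integral)
  then show "expectation ?q \<le> \<sigma>\<^sup>2" by simp
qed

text \<open>Let m(u) be the mean of g(u, .) over the sample. Freezing the iterate shows that m(Y) is
  a version of the conditional expectation given Y = h(X); by uniqueness it equals the gradient
  almost everywhere. The assumption thus becomes a statement about averages at a frozen
  iterate.\<close>

lemma stochastic_gradient_unbiased:
  fixes g :: "real^'p \<Rightarrow> 'd::euclidean_space \<Rightarrow> real^'p" and X :: "'a \<Rightarrow> 'x::euclidean_space"
    and \<xi> :: "'n \<Rightarrow> 'a \<Rightarrow> 'd"
  assumes fresh: "fresh_samples M X \<xi>" and X[measurable]: "X \<in> borel_measurable M"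
    and h[measurable]: "h \<in> borel_measurable borel"
    and g[measurable]: "(\<lambda>(u, z). g u z) \<in> borel_measurable (borel \<Otimes>\<^sub>M borel)"
    and sg: "stochastic_gradient M \<sigma> f (\<lambda>\<omega>. h (X \<omega>)) (\<lambda>\<omega>. g (h (X \<omega>)) (\<xi> i \<omega>))"
  shows "AE \<omega> in M. integrable M (\<lambda>\<omega>'. g (h (X \<omega>)) (\<xi> i \<omega>'))
    \<and> expectation (\<lambda>\<omega>'. g (h (X \<omega>)) (\<xi> i \<omega>')) = grad f (h (X \<omega>))"
proof -
  let ?P = "PiM UNIV (\<lambda>_. borel) :: ('n \<Rightarrow> 'd) measure"
  note \<xi>[measurable] = fresh_samples_measurable[OF fresh]
  define Y where "Y \<omega> = h (X \<omega>)" for \<omega>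
  define m where "m u = expectation (\<lambda>\<omega>'. g u (\<xi> i \<omega>'))" for u
  have [measurable]: "Y \<in> borel_measurable M" unfolding Y_def by measurable
  interpret finite_measure_subalgebra M "gen_alg M borel Y" by (rule gen_alg_subalgebra) fact
  have m[measurable]: "m \<in> borel_measurable borel"
    unfolding m_def by measurable
  have gP[measurable]: "(\<lambda>p. g (h (fst p)) (snd p i)) \<in> borel_measurable (borel \<Otimes>\<^sub>M ?P)"
    using measurable_compose[OF _ g, of "\<lambda>p. (h (fst p), snd p i)" "borel \<Otimes>\<^sub>M ?P"] by simp
  have int: "integrable M (\<lambda>\<omega>. g (Y \<omega>) (\<xi> i \<omega>))"
    using sg by (simp add: stochastic_gradient_def Y_def)
  note dec = fresh_samples_AE_integrable[OF fresh X gP, unfolded fst_conv snd_conv, folded Y_def, OF int]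
    fresh_samples_integrable[OF fresh X gP, unfolded fst_conv snd_conv, folded Y_def, OF int]
  have "AE \<omega> in M. real_cond_exp M (gen_alg M borel Y) (\<lambda>\<omega>. g (Y \<omega>) (\<xi> i \<omega>) $ j) \<omega> = m (Y \<omega>) $ j" for j
  proof (rule real_cond_exp_charact)
    show "(\<lambda>\<omega>. m (Y \<omega>) $ j) \<in> borel_measurable (gen_alg M borel Y)"
    proof -
      have [measurable]: "Y \<in> borel_measurable (gen_alg M borel Y)"
        unfolding gen_alg_def by (rule measurable_vimage_algebra1) auto
      have "(\<lambda>\<omega>. m (Y \<omega>) \<bullet> axis j 1) \<in> borel_measurable (gen_alg M borel Y)" by measurable
      then show ?thesis by (simp add: inner_axis)
    qed
    show comp: "integrable M (\<lambda>\<omega>. g (Y \<omega>) (\<xi> i \<omega>) $ j)"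
      using integrable_inner_left[OF int, of "axis j 1"] by (simp add: inner_axis)
    show mint: "integrable M (\<lambda>\<omega>. m (Y \<omega>) $ j)"
      using integrable_inner_left[OF dec(2), of "axis j 1"] by (simp add: inner_axis m_def)
    fix A assume "A \<in> sets (gen_alg M borel Y)"
    then obtain B where B[measurable]: "B \<in> sets borel" and A: "A = Y -` B \<inter> space M"
      unfolding gen_alg_def by (subst (asm) sets_vimage_algebra2) auto
    \<comment> \<open>Since A is the preimage of B under Y, its indicator depends on the iterate
      alone and passes through the inner integral.\<close>
    define F where "F p = indicator B (h (fst p)) * (g (h (fst p)) (snd p i) $ j)" for p
    have "(\<lambda>p. indicator B (h (fst p)) * (g (h (fst p)) (snd p i) \<bullet> axis j 1)) \<in> borel_measurable (borel \<Otimes>\<^sub>M ?P)"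
      by measurable
    then have F: "F \<in> borel_measurable (borel \<Otimes>\<^sub>M ?P)" by (simp add: F_def[abs_def] inner_axis)
    have intF: "integrable M (\<lambda>\<omega>. indicator B (Y \<omega>) * (g (Y \<omega>) (\<xi> i \<omega>) $ j))"
    proof (rule Bochner_Integration.integrable_bound[OF comp])
      have [measurable]: "(\<lambda>\<omega>. g (Y \<omega>) (\<xi> i \<omega>) $ j) \<in> borel_measurable M"
        using comp by (rule borel_measurable_integrable)
      show "(\<lambda>\<omega>. indicator B (Y \<omega>) * (g (Y \<omega>) (\<xi> i \<omega>) $ j)) \<in> borel_measurable M" by measurable
    qed (auto simp: indicator_def)
    have "(\<integral>\<omega>\<in>A. (g (Y \<omega>) (\<xi> i \<omega>) $ j) \<partial>M) = (\<integral>\<omega>. indicator B (Y \<omega>) * (g (Y \<omega>) (\<xi> i \<omega>) $ j) \<partial>M)"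
      unfolding set_lebesgue_integral_def A
      by (intro Bochner_Integration.integral_cong) (auto simp: indicator_def)
    also have "\<dots> = (\<integral>\<omega>. (\<integral>\<omega>'. indicator B (Y \<omega>) * (g (Y \<omega>) (\<xi> i \<omega>') $ j) \<partial>M) \<partial>M)"
      by (rule fresh_samples_integral[OF fresh X F, unfolded F_def fst_conv snd_conv, folded Y_def, OF intF])
    also have "\<dots> = (\<integral>\<omega>. indicator B (Y \<omega>) * (m (Y \<omega>) $ j) \<partial>M)"
    proof (rule integral_cong_AE)
      show "(\<lambda>\<omega>. \<integral>\<omega>'. indicator B (Y \<omega>) * (g (Y \<omega>) (\<xi> i \<omega>') $ j) \<partial>M) \<in> borel_measurable M"
        using fresh_samples_integrable[OF fresh X F, unfolded F_def fst_conv snd_conv, folded Y_def, OF intF]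
        by (rule borel_measurable_integrable)
      show "AE \<omega> in M. (\<integral>\<omega>'. indicator B (Y \<omega>) * (g (Y \<omega>) (\<xi> i \<omega>') $ j) \<partial>M) = indicator B (Y \<omega>) * (m (Y \<omega>) $ j)"
        using dec(1)
      proof eventually_elim
        case (elim \<omega>)
        from integral_inner_left[OF elim, of "axis j 1"] show ?case
          by (simp add: m_def inner_axis)
      qed
      have [measurable]: "(\<lambda>\<omega>. m (Y \<omega>) $ j) \<in> borel_measurable M"
        using mint by (rule borel_measurable_integrable)
      show "(\<lambda>\<omega>. indicator B (Y \<omega>) * (m (Y \<omega>) $ j)) \<in> borel_measurable M" by measurable
    qed
    also have "\<dots> = (\<integral>\<omega>\<in>A. (m (Y \<omega>) $ j) \<partial>M)"
      unfolding set_lebesgue_integral_def A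
      by (intro Bochner_Integration.integral_cong) (auto simp: indicator_def)
    finally show "(\<integral>\<omega>\<in>A. (g (Y \<omega>) (\<xi> i \<omega>) $ j) \<partial>M) = (\<integral>\<omega>\<in>A. (m (Y \<omega>) $ j) \<partial>M)" .
  qed
  then have "AE \<omega> in M. \<forall>j. real_cond_exp M (gen_alg M borel Y) (\<lambda>\<omega>. g (Y \<omega>) (\<xi> i \<omega>) $ j) \<omega> = m (Y \<omega>) $ j"
    by (simp add: AE_all_countable)
  moreover have "AE \<omega> in M. vec_cond_exp M (gen_alg M borel Y) (\<lambda>\<omega>. g (Y \<omega>) (\<xi> i \<omega>)) \<omega> = grad f (Y \<omega>)"
    using sg by (simp add: stochastic_gradient_def Y_def[abs_def])
  ultimately have "AE \<omega> in M. m (Y \<omega>) = grad f (Y \<omega>)"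
    by eventually_elim (auto simp: vec_eq_iff vec_cond_exp_def)
  with dec(1) show ?thesis
    unfolding Y_def m_def by eventually_elim simp
qed

end

subsection \<open>Convergence of the average iterates\<close>

lemma GDERIV_sum:
  assumes "\<And>i. i \<in> I \<Longrightarrow> GDERIV (f i) x :> G i"
  shows "GDERIV (\<lambda>x. \<Sum>i\<in>I. f i x) x :> (\<Sum>i\<in>I. G i)"
  using has_derivative_sum[of I f "\<lambda>i h. h \<bullet> G i" "at x"] assms
  by (simp add: gderiv_def inner_sum_right)

lemma lipschitz_on_sum:
  fixes G :: "'i \<Rightarrow> 'a::metric_space \<Rightarrow> 'b::real_normed_vector"
  assumes "\<And>i. i \<in> I \<Longrightarrow> (L i)-lipschitz_on S (G i)"
  shows "(\<Sum>i\<in>I. L i)-lipschitz_on S (\<lambda>x. \<Sum>i\<in>I. G i x)"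
proof (rule lipschitz_onI)
  fix x y assume xy: "x \<in> S" "y \<in> S"
  have "dist (\<Sum>i\<in>I. G i x) (\<Sum>i\<in>I. G i y) \<le> (\<Sum>i\<in>I. dist (G i x) (G i y))"
    by (simp add: dist_norm sum_subtractf[symmetric] norm_sum)
  also have "\<dots> \<le> (\<Sum>i\<in>I. L i * dist x y)"
    by (intro sum_mono lipschitz_onD[OF assms] xy)
  finally show "dist (\<Sum>i\<in>I. G i x) (\<Sum>i\<in>I. G i y) \<le> (\<Sum>i\<in>I. L i) * dist x y"
    by (simp add: sum_distrib_right)
qed (rule sum_nonneg, rule lipschitz_on_nonneg[OF assms])

lemma strongly_convex_sum:
  assumes "finite I" "I \<noteq> {}" "\<And>i. i \<in> I \<Longrightarrow> strongly_convex (\<mu> i) (f i)"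
  shows "strongly_convex (\<Sum>i\<in>I. \<mu> i) (\<lambda>x. \<Sum>i\<in>I. f i x)"
proof -
  have "convex_on UNIV (\<lambda>x. \<Sum>i\<in>I. f i x - \<mu> i / 2 * (norm x)\<^sup>2)"
    using assms(1) assms(3)
  proof (induction I)
    case (insert i I)
    then show ?case by (auto intro: convex_on_add simp: strongly_convex_def)
  qed (simp add: convex_on_const)
  moreover have "(\<Sum>i\<in>I. \<mu> i) > 0"
    using assms by (intro sum_pos) (auto simp: strongly_convex_def)
  ultimately show ?thesis
    by (simp add: strongly_convex_def sum_subtractf sum_distrib_right sum_divide_distrib)
qed

lemma strongly_convex_scale:
  assumes "strongly_convex \<mu> f" "0 < c"
  shows "strongly_convex (c * \<mu>) (\<lambda>x. c * f x)"
proof -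
  have "convex_on UNIV (\<lambda>x. c * (f x - \<mu> / 2 * (norm x)\<^sup>2))"
    using assms by (intro convex_on_cmul) (auto simp: strongly_convex_def)
  then show ?thesis using assms by (simp add: strongly_convex_def algebra_simps)
qed

lemma L_smooth_imp_measurable_grad:
  fixes f :: "real^'p \<Rightarrow> real"
  shows "L_smooth L f \<Longrightarrow> grad f \<in> borel_measurable borel"
  by (auto simp: L_smooth_def intro: borel_measurable_continuous_onI lipschitz_on_continuous_on)

lemma norm_sum_sq_le:
  "(norm (\<Sum>i\<in>I. a i))\<^sup>2 \<le> real (card I) * (\<Sum>i\<in>I. (norm (a i))\<^sup>2)"
proof -
  have "(norm (\<Sum>i\<in>I. a i))\<^sup>2 \<le> (\<Sum>i\<in>I. norm (a i))\<^sup>2"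
    by (intro power_mono norm_sum) auto
  also have "\<dots> \<le> (\<Sum>i\<in>I. (norm (a i))\<^sup>2) * real (card I)"
    by (cases "finite I") (auto intro: sum_squared_le_sum_of_squares)
  finally show ?thesis by (simp add: mult.commute)
qed

lemma linear_block: "linear (\<lambda>x. block x i)"
  by (rule linearI) (simp_all add: block_def vec_eq_iff)

lemma borel_measurable_block: "(\<lambda>x. block x i) \<in> borel_measurable borel"
  by (intro borel_measurable_continuous_onI linear_continuous_on linear_block
      linear_conv_bounded_linear[THEN iffD1])

lemma block_stack: "block (stack u) i = u i"
  by (simp add: block_def stack_def vec_eq_iff)

lemma borel_measurable_avg: "avg \<in> borel_measurable borel"
  unfolding avg_def[abs_def] by (intro borel_measurable_scaleR borel_measurable_const borel_measurable_sum borel_measurable_block)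

lemma borel_measurable_stack:
  fixes u :: "'n::finite \<Rightarrow> 'w \<Rightarrow> real^'p::finite"
  assumes [measurable]: "\<And>i. u i \<in> borel_measurable M"
  shows "(\<lambda>\<omega>. stack (\<lambda>i. u i \<omega>)) \<in> borel_measurable M"
proof (subst borel_measurable_euclidean_space, safe)
  fix b :: "real^('n \<times> 'p)" assume "b \<in> Basis"
  then obtain r where "b = axis r 1" by (auto simp: Basis_vec_def)
  then show "(\<lambda>\<omega>. stack (\<lambda>i. u i \<omega>) \<bullet> b) \<in> borel_measurable M"
    using measurable_compose[OF assms borel_measurable_nth] by (simp add: inner_axis stack_def)
qed

text \<open>The reference point u need not be fixed by mixing. Its displacement has norm at most
  2|u|, whose square is the origin of the 4 here and of the 8 in \<open>Dsq\<close>.\<close>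

lemma norm_kron_consensus_diff_sq_le:
  fixes y u :: "real^('n::finite \<times> 'p::finite)"
  assumes net: "connected_network E" "consensus_matrix E W" and "0 < t"
  shows "(norm (matpow (kron W (mat 1)) k *v y - u))\<^sup>2
    \<le> (1 + t) * (norm (y - u))\<^sup>2 + 4 * (1 + inverse t) * (norm u)\<^sup>2"
proof -
  let ?A = "matpow (kron W (mat 1 :: real^'p^'p)) k"
  have "?A *v y - u = ?A *v (y - u) + (?A *v u - u)"
    by (simp add: matrix_vector_mult_diff_distrib)
  then have "(norm (?A *v y - u))\<^sup>2
      \<le> (1 + t) * (norm (?A *v (y - u)))\<^sup>2 + (1 + inverse t) * (norm (?A *v u - u))\<^sup>2"
    using norm_add_sq_le[OF \<open>0 < t\<close>] by metis
  also have "\<dots> \<le> (1 + t) * (norm (y - u))\<^sup>2 + (1 + inverse t) * (2 * norm u)\<^sup>2"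
  proof (intro add_mono mult_left_mono power_mono)
    show "norm (?A *v (y - u)) \<le> norm (y - u)" by (rule norm_kron_consensus_le[OF net])
    show "norm (?A *v u - u) \<le> 2 * norm u"
      using norm_triangle_ineq4[of "?A *v u" u] norm_kron_consensus_le[OF net, of k u] by linarith
  qed (use \<open>0 < t\<close> in auto)
  finally show ?thesis by (simp add: power_mult_distrib algebra_simps)
qed

text \<open>The guard on the bound for \<psi> covers 2 \<alpha> \<open>\<gamma>f\<close> = 1, where
  the bound is infinite on paper but 0 under division by zero. Integrability is asserted because the
  expectation of a nonintegrable function defaults to 0, and \<theta> < 1 makes the rate genuine.
  \<open>avg y0\<close> is the initial average, as \<open>x 0\<close> equals
  \<open>y 0\<close>.\<close>

theorem mainTheorem3:
  fixes M :: "'w measure"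
    and E :: "('n::finite \<times> 'n) set"
    and W :: "real^'n^'n"
    and Z :: "real^('n \<times> 'p::finite)^('n \<times> 'p)"
    and f :: "'n \<Rightarrow> real^'p \<Rightarrow> real"
    and \<mu> Ls :: "'n \<Rightarrow> real"
    and g :: "'n \<Rightarrow> real^'p \<Rightarrow> 'd::euclidean_space \<Rightarrow> real^'p"
    and \<xi> :: "'n \<Rightarrow> nat \<Rightarrow> 'w \<Rightarrow> 'd"
    and y0 ustar :: "real^('n \<times> 'p)"
    and x y :: "nat \<Rightarrow> 'w \<Rightarrow> real^('n \<times> 'p)"
    and xstar :: "real^'p"
    and \<alpha> \<sigma> \<psi> \<beta> L \<gamma> \<nu> \<Delta> Dsq \<mu>f Lf \<gamma>f c1 c2sq C \<theta> :: real
  assumes "prob_space M"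
    and "connected_network E"
    and "consensus_matrix E W"
    and "Z = kron W (mat 1)"
    and "\<beta> = second_singular_value W"
    and "\<And>i. strongly_convex (\<mu> i) (f i)"
    and "\<And>i. L_smooth (Ls i) (f i)"
    and "\<alpha> > 0"
    and "\<alpha> \<le> Min (range (\<lambda>i. 2 / (\<mu> i + Ls i)))"
    and "\<And>\<omega>. y 0 \<omega> = y0"
    and "\<And>k \<omega>. x k \<omega> = matpow Z k *v y k \<omega>"
    and "\<And>k \<omega>. y (Suc k) \<omega> = x k \<omega> - \<alpha> *\<^sub>R stack (\<lambda>i. g i (block (x k \<omega>) i) (\<xi> i k \<omega>))"
    and "\<sigma> > 0"
    and "\<And>i. (\<lambda>(u, z). g i u z) \<in> borel_measurable (borel \<Otimes>\<^sub>M borel)"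
    and "\<And>k. fresh_samples M (x k) (\<lambda>i. \<xi> i k)"
    and "\<And>i k. stochastic_gradient M \<sigma> (f i) (\<lambda>\<omega>. block (x k \<omega>) i)
                 (\<lambda>\<omega>. g i (block (x k \<omega>) i) (\<xi> i k \<omega>))"
    and "xstar = argmin (\<lambda>u. \<Sum>i\<in>UNIV. f i u)"
    and "ustar = stack (\<lambda>i. argmin (f i))"
    and "L = Max (range Ls)"
    and "\<gamma> = Min (range (\<lambda>i. \<mu> i * Ls i / (\<mu> i + Ls i)))"
    and "\<nu> = 2 * \<alpha> * \<gamma>"
    and "\<Delta> = real CARD('n) * \<alpha>\<^sup>2 * \<sigma>\<^sup>2"
    and "Dsq = 2 * (norm (y0 - ustar))\<^sup>2 + (8 + 2 * \<nu> ^ 3) / \<nu> ^ 3 * (norm ustar)\<^sup>2 + 2 / \<nu>\<^sup>2 * \<Delta>"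
    and "\<mu>f = (\<Sum>i\<in>UNIV. \<mu> i) / real CARD('n)"
    and "Lf = (\<Sum>i\<in>UNIV. Ls i) / real CARD('n)"
    and "\<gamma>f = \<mu>f * Lf / (\<mu>f + Lf)"
    and "\<psi> > 0"
    and "2 * \<alpha> * \<gamma>f \<noteq> 1 \<longrightarrow> \<psi> < 2 * \<alpha> * \<gamma>f / (1 - 2 * \<alpha> * \<gamma>f)"
    and "c1 = (1 + \<psi>) * (1 - 2 * \<alpha> * \<gamma>f)"
    and "c2sq = \<alpha>\<^sup>2 * (1 + inverse \<psi>) * L\<^sup>2 * Dsq"
    and "C = max ((norm (avg y0 - xstar))\<^sup>2) (2 * c2sq / (1 - c1))"
    and "\<theta> = max (\<beta>\<^sup>2) ((c1 + 1) / 2)"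
  shows "\<theta> < 1 \<and>
    (\<forall>k. integrable M (\<lambda>\<omega>. (norm (avg (x k \<omega>) - xstar))\<^sup>2) \<and>
         prob_space.expectation M (\<lambda>\<omega>. (norm (avg (x k \<omega>) - xstar))\<^sup>2)
           \<le> C * \<theta> ^ k + \<alpha>\<^sup>2 * \<sigma>\<^sup>2 / (real CARD('n) * (1 - c1)))"
proof -
  interpret prob_space M by fact
  note net = assms(2,3) and conv = assms(6) and smooth = assms(7) and y0 = assms(10)
    and step_x = assms(11) and step_y = assms(12) and g_meas = assms(14) and fresh = assms(15)
    and sg = assms(16)

  \<comment> \<open>Ranges of the constants\<close>
  define n where "n = real CARD('n)"
  have n: "n \<ge> 1" by (simp add: n_def Suc_le_eq)
  have grad: "GDERIV (f i) u :> grad (f i) u" and lip: "(Ls i)-lipschitz_on UNIV (grad (f i))" for i u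
    using smooth[of i] by (auto simp: L_smooth_def)
  have \<mu>_pos: "\<mu> i > 0" for i using conv[of i] by (simp add: strongly_convex_def)
  have \<mu>_le: "\<mu> i \<le> Ls i" for i by (rule strongly_convex_le_lipschitz[OF grad lip conv])
  have \<alpha>: "0 \<le> \<alpha>" "\<alpha> \<le> 2 / (\<mu> i + Ls i)" for i
    using assms(8,9) by auto
  have \<alpha>_pos: "\<alpha> > 0" by fact
  have \<gamma>_le: "\<gamma> \<le> \<mu> i * Ls i / (\<mu> i + Ls i)" for i
    by (simp add: assms(20))
  have \<gamma>_pos: "\<gamma> > 0"
  proof -
    have "\<mu> i * Ls i / (\<mu> i + Ls i) > 0" for i
      using \<mu>_pos[of i] \<mu>_le[of i] by (intro divide_pos_pos mult_pos_pos add_pos_pos) auto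
    then show ?thesis by (simp add: assms(20))
  qed
  have \<nu>_le: "\<nu> \<le> 2 * \<alpha> * (\<mu> i * Ls i / (\<mu> i + Ls i))" for i
    unfolding assms(21) by (intro mult_left_mono \<gamma>_le) (use \<alpha>_pos in auto)
  have \<nu>: "0 < \<nu>" "\<nu> \<le> 1"
  proof -
    show "0 < \<nu>" using \<alpha>_pos \<gamma>_pos by (simp add: assms(21))
    show "\<nu> \<le> 1"
      \<comment> \<open>One arbitrary agent suffices, since \<gamma> is a minimum over all
        agents.\<close>
      using order_trans[OF \<nu>_le gradient_step_factor_nonneg[OF grad lip conv \<alpha>, of undefined, unfolded diff_ge_0_iff_ge]] .
  qed
  have Ls_le: "Ls i \<le> L" for i by (simp add: assms(19))
  have L_lip: "L-lipschitz_on UNIV (grad (f i))" for i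
    by (rule lipschitz_on_mono[OF lip _ Ls_le]) auto
  have L_nonneg: "0 \<le> L" by (rule lipschitz_on_nonneg[OF L_lip])

  \<comment> \<open>The averaged objective\<close>
  define favg where "favg u = (1 / n) * (\<Sum>i\<in>UNIV. f i u)" for u
  define gavg where "gavg u = (1 / n) *\<^sub>R (\<Sum>i\<in>UNIV. grad (f i) u)" for u
  have sum_grad: "GDERIV (\<lambda>u. \<Sum>i\<in>UNIV. f i u) u :> (\<Sum>i\<in>UNIV. grad (f i) u)" for u
    by (rule GDERIV_sum[OF grad])
  have sum_lip: "(\<Sum>i\<in>UNIV. Ls i)-lipschitz_on UNIV (\<lambda>u. \<Sum>i\<in>UNIV. grad (f i) u)"
    by (rule lipschitz_on_sum[OF lip])
  have sum_conv: "strongly_convex (\<Sum>i\<in>UNIV. \<mu> i) (\<lambda>u. \<Sum>i\<in>UNIV. f i u)"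
    by (rule strongly_convex_sum) (auto intro: conv)
  have favg_grad: "GDERIV favg u :> gavg u" for u
    using GDERIV_mult[OF GDERIV_const[of "1 / n"] sum_grad[of u]]
    by (simp add: favg_def[abs_def] gavg_def)
  have favg_lip: "Lf-lipschitz_on UNIV gavg"
    using lipschitz_on_cmult[OF sum_lip, of "1 / n"] n
    by (simp add: gavg_def[abs_def] assms(25) n_def)
  have favg_conv: "strongly_convex \<mu>f favg"
    using strongly_convex_scale[OF sum_conv, of "1 / n"] n
    by (simp add: favg_def[abs_def] assms(24) n_def)
  have \<alpha>_favg: "\<alpha> \<le> 2 / (\<mu>f + Lf)"
  proof -
    have pos: "0 < \<mu>f + Lf"
      using strongly_convex_le_lipschitz[OF favg_grad favg_lip favg_conv] favg_conv
      by (simp add: strongly_convex_def)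
    \<comment> \<open>In product form the steplength condition is linear in the constants and can be
      averaged over the agents.\<close>
    have "\<alpha> * (\<mu> i + Ls i) \<le> 2" for i
      using \<alpha>(2)[of i] \<mu>_pos[of i] \<mu>_le[of i] by (simp add: field_simps)
    then have "(\<Sum>i\<in>UNIV. \<alpha> * (\<mu> i + Ls i)) \<le> (\<Sum>i\<in>(UNIV :: 'n set). 2)"
      by (rule sum_mono)
    also have "(\<Sum>i\<in>UNIV. \<alpha> * (\<mu> i + Ls i)) = n * (\<alpha> * (\<mu>f + Lf))"
      using n by (simp add: assms(24,25) n_def sum_distrib_left[symmetric] sum.distrib field_simps)
    finally have "n * (\<alpha> * (\<mu>f + Lf)) \<le> n * 2" by (simp add: n_def)
    then have "\<alpha> * (\<mu>f + Lf) \<le> 2" using n by (simp only: mult_le_cancel_left_pos)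
    then show ?thesis using pos by (simp add: pos_le_divide_eq)
  qed
  have xstar: "gavg xstar = 0"
    using gradient_argmin_eq_0[OF sum_grad sum_lip sum_conv] by (simp add: gavg_def assms(17))
  have ustar: "grad (f i) (block ustar i) = 0" for i
    using gradient_argmin_eq_0[OF grad lip conv] by (simp add: assms(18) block_stack)
  have factor: "0 \<le> 1 - 2 * \<alpha> * \<gamma>f"
    unfolding assms(26)
    by (rule gradient_step_factor_nonneg[OF favg_grad favg_lip favg_conv \<alpha>(1) \<alpha>_favg])
  have \<psi>: "0 < \<psi>" by fact
  have c1: "0 \<le> c1" "c1 < 1"
  proof -
    show "0 \<le> c1" using factor \<psi> by (simp add: assms(29))
    show "c1 < 1"
    \<comment> \<open>In the degenerate case nothing bounds \<psi> from above, but \<open>c1\<close>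
      is 0.\<close>
    proof (cases "2 * \<alpha> * \<gamma>f = 1")
      case False
      then have "\<psi> * (1 - 2 * \<alpha> * \<gamma>f) < 2 * \<alpha> * \<gamma>f"
        using assms(28) factor by (simp add: pos_less_divide_eq)
      then show ?thesis by (simp add: assms(29) algebra_simps)
    qed (simp add: assms(29))
  qed
  have \<beta>: "0 \<le> \<beta>" "\<beta> < 1"
    using second_singular_value_nonneg second_singular_value_consensus_less_1[OF net]
    by (auto simp: assms(5))

  \<comment> \<open>Measurability of the iterates\<close>
  have block_meas: "(\<lambda>u :: real^('n \<times> 'p). block u i) \<in> borel_measurable borel" for i
    by (rule borel_measurable_block)
  have grad_meas: "grad (f i) \<in> borel_measurable borel" for i
    by (rule L_smooth_imp_measurable_grad[OF smooth])
  note [measurable] = block_meas grad_meas g_meas borel_measurable_avg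
  have mat_meas: "(\<lambda>\<omega>. A *v h \<omega>) \<in> borel_measurable M" if "h \<in> borel_measurable M"
    for A :: "real^('n \<times> 'p)^('n \<times> 'p)" and h
  proof (rule measurable_compose[OF that])
    show "(\<lambda>v. A *v v) \<in> borel_measurable borel"
      by (intro borel_measurable_continuous_onI linear_continuous_on
          linear_conv_bounded_linear[THEN iffD1]) auto
  qed
  have G_meas: "(\<lambda>\<omega>. g i (block (x k \<omega>) i) (\<xi> i k \<omega>)) \<in> borel_measurable M" for i k
    using sg[of i k] by (simp add: stochastic_gradient_def borel_measurable_integrable)
  have y_meas[measurable]: "y k \<in> borel_measurable M" for k
  proof (induction k)
    case 0
    have "y 0 = (\<lambda>_. y0)" using y0 by auto
    then show ?case by simp
  next
    case (Suc k)
    have "y (Suc k) = (\<lambda>\<omega>. matpow Z k *v y k \<omega>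
        - \<alpha> *\<^sub>R stack (\<lambda>i. g i (block (x k \<omega>) i) (\<xi> i k \<omega>)))"
      using step_x step_y by auto
    then show ?case
      by (simp add: borel_measurable_diff mat_meas[OF Suc] borel_measurable_scaleR borel_measurable_stack G_meas)
  qed
  have x_meas[measurable]: "x k \<in> borel_measurable M" for k
  proof -
    have "x k = (\<lambda>\<omega>. matpow Z k *v y k \<omega>)" using step_x by auto
    then show ?thesis using mat_meas[OF y_meas] by simp
  qed

  \<comment> \<open>Second moments of the noise\<close>
  define e where "e i u z = g i (block u i) z - grad (f i) (block u i)"
    for i and u :: "real^('n \<times> 'p)" and z
  \<comment> \<open>General \<open>c\<close> and \<open>I\<close> serve two uses: c = -\<alpha> on a
    singleton for one local step, and c = -\<alpha>/n on all agents for the average.\<close>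
  have noise: "integrable M (\<lambda>\<omega>. (norm (v (x k \<omega>) + (\<Sum>i\<in>I. c *\<^sub>R e i (x k \<omega>) (\<xi> i k \<omega>))))\<^sup>2)
      \<and> expectation (\<lambda>\<omega>. (norm (v (x k \<omega>) + (\<Sum>i\<in>I. c *\<^sub>R e i (x k \<omega>) (\<xi> i k \<omega>))))\<^sup>2)
        \<le> expectation (\<lambda>\<omega>. (norm (v (x k \<omega>)))\<^sup>2) + c\<^sup>2 * (real (card I) * \<sigma>\<^sup>2)"
    if v: "v \<in> borel_measurable borel" and vsq: "integrable M (\<lambda>\<omega>. (norm (v (x k \<omega>)))\<^sup>2)"
    for v :: "real^('n \<times> 'p) \<Rightarrow> real^'p" and c k I
  proof -
    have var: "integrable M (\<lambda>\<omega>. (norm (e i (x k \<omega>) (\<xi> i k \<omega>)))\<^sup>2)"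
      "expectation (\<lambda>\<omega>. (norm (e i (x k \<omega>) (\<xi> i k \<omega>)))\<^sup>2) \<le> \<sigma>\<^sup>2" for i
      unfolding e_def by (rule stochastic_gradient_variance[OF sg _ grad_meas]; measurable)+
    have meas: "(\<lambda>(u, z). c *\<^sub>R e i u z) \<in> borel_measurable (borel \<Otimes>\<^sub>M borel)" for i
    proof -
      have "(\<lambda>p. g i (block (fst p) i) (snd p)) \<in> borel_measurable (borel \<Otimes>\<^sub>M borel)"
        using measurable_compose[OF _ g_meas[of i], of "\<lambda>p. (block (fst p) i, snd p)" "borel \<Otimes>\<^sub>M borel"]
        by simp
      then show ?thesis unfolding e_def split_beta by measurable
    qed
    have centered: "AE \<omega> in M. integrable M (\<lambda>\<omega>'. c *\<^sub>R e i (x k \<omega>) (\<xi> i k \<omega>'))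
        \<and> expectation (\<lambda>\<omega>'. c *\<^sub>R e i (x k \<omega>) (\<xi> i k \<omega>')) = 0" for i
      using stochastic_gradient_unbiased[OF fresh[of k] x_meas block_meas[of i] g_meas[of i] sg[of i k]]
    proof eventually_elim
      case (elim \<omega>)
      then show ?case by (simp add: e_def prob_space)
    qed
    have sq: "integrable M (\<lambda>\<omega>. (norm (c *\<^sub>R e i (x k \<omega>) (\<xi> i k \<omega>)))\<^sup>2)" for i
      using var(1)[of i] by (simp add: power_mult_distrib)
    have "(\<Sum>i\<in>I. expectation (\<lambda>\<omega>. (norm (c *\<^sub>R e i (x k \<omega>) (\<xi> i k \<omega>)))\<^sup>2)) \<le> (\<Sum>i\<in>I. c\<^sup>2 * \<sigma>\<^sup>2)"
      using var(2) by (intro sum_mono) (simp add: power_mult_distrib mult_left_mono)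
    then show ?thesis
      using fresh_samples_norm_sq[OF fresh x_meas meas v centered sq vsq, of I] by (simp add: mult_ac)
  qed

  \<comment> \<open>Uniform second moment bound for the local iterates\<close>
  define A where "A k = expectation (\<lambda>\<omega>. (norm (y k \<omega> - ustar))\<^sup>2)" for k
  \<comment> \<open>The recursion is A(k+1) <= (1 - \<nu>^2) A(k) + 4 (1 - \<nu>^2) / \<nu>
    |ustar|^2 + \<Delta>. \<open>B\<close> is its fixed point with one factor 1 - \<nu>^2 rounded up
    to 1, plus the initial distance for k = 0; \<open>Dsq\<close> is 2 \<open>B\<close> + 2
    |ustar|^2.\<close>
  define B where "B = (norm (y0 - ustar))\<^sup>2 + 4 / \<nu> ^ 3 * (norm ustar)\<^sup>2 + \<Delta> / \<nu>\<^sup>2"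
  have y_bound: "integrable M (\<lambda>\<omega>. (norm (y k \<omega> - ustar))\<^sup>2) \<and> A k \<le> B" for k
  proof (induction k)
    case 0
    have "\<Delta> \<ge> 0" by (simp add: assms(22))
    then show ?case using \<nu> by (simp add: A_def B_def y0 prob_space)
  next
    case (Suc k)
    then have int: "integrable M (\<lambda>\<omega>. (norm (y k \<omega> - ustar))\<^sup>2)" and AB: "A k \<le> B" by auto
    let ?b = "\<lambda>\<omega>. (1 + \<nu>) * (norm (y k \<omega> - ustar))\<^sup>2 + 4 * (1 + inverse \<nu>) * (norm ustar)\<^sup>2"
    have x_le: "(norm (x k \<omega> - ustar))\<^sup>2 \<le> ?b \<omega>" for \<omega>
      unfolding step_x assms(4) by (rule norm_kron_consensus_diff_sq_le[OF net \<nu>(1)])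
    have int_x: "integrable M (\<lambda>\<omega>. (norm (x k \<omega> - ustar))\<^sup>2)"
    proof (rule Bochner_Integration.integrable_bound)
      show "integrable M ?b" using int by simp
      show "AE \<omega> in M. norm ((norm (x k \<omega> - ustar))\<^sup>2) \<le> norm (?b \<omega>)"
        using x_le by (intro AE_I2) (simp add: order_trans[OF _ abs_ge_self])
    qed measurable
    have Ex: "expectation (\<lambda>\<omega>. (norm (x k \<omega> - ustar))\<^sup>2)
        \<le> (1 + \<nu>) * A k + 4 * (1 + inverse \<nu>) * (norm ustar)\<^sup>2"
    proof -
      have "expectation (\<lambda>\<omega>. (norm (x k \<omega> - ustar))\<^sup>2) \<le> expectation ?b"
        using int by (intro integral_mono int_x x_le) simp
      also have "\<dots> = (1 + \<nu>) * A k + 4 * (1 + inverse \<nu>) * (norm ustar)\<^sup>2"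
        using int by (simp add: A_def prob_space)
      finally show ?thesis .
    qed
    \<comment> \<open>The local step with exact gradient, relative to the local minimizer; the
      gradient vanishes there, so the minimizer is a fixed point of the step.\<close>
    define v where "v i u = block u i - \<alpha> *\<^sub>R grad (f i) (block u i) - block ustar i" for i u
    have v_meas[measurable]: "v i \<in> borel_measurable borel" for i unfolding v_def by measurable
    have v_le: "(norm (v i u))\<^sup>2 \<le> (1 - \<nu>) * (norm (block (u - ustar) i))\<^sup>2" for i u
    proof -
      have "(norm (v i u))\<^sup>2 \<le> (1 - 2 * \<alpha> * (\<mu> i * Ls i / (\<mu> i + Ls i))) * (norm (block u i - block ustar i))\<^sup>2"
        using gradient_step_contraction[OF grad[of i] lip[of i] conv[of i] \<alpha>(1) \<alpha>(2)[of i], where x = "block u i" and y = "block ustar i"]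
        by (simp add: v_def ustar)
      also have "\<dots> \<le> (1 - \<nu>) * (norm (block u i - block ustar i))\<^sup>2"
        using \<nu>_le[of i] by (intro mult_right_mono) auto
      finally show ?thesis by (simp add: linear_diff[OF linear_block])
    qed
    have block_le: "(norm (block u i))\<^sup>2 \<le> (norm u)\<^sup>2" for u :: "real^('n \<times> 'p)" and i
      unfolding norm_sq_eq_sum_block[of u] by (rule member_le_sum) auto
    have int_block: "integrable M (\<lambda>\<omega>. (norm (block (x k \<omega> - ustar) i))\<^sup>2)" for i
      by (rule Bochner_Integration.integrable_bound[OF int_x]) (auto simp: block_le)
    have int_v: "integrable M (\<lambda>\<omega>. (norm (v i (x k \<omega>)))\<^sup>2)" for i
      by (rule Bochner_Integration.integrable_bound[OF integrable_mult_right[OF int_block[of i], of "1 - \<nu>"]])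
        (auto intro!: order_trans[OF v_le] mult_nonneg_nonneg simp: abs_mult \<nu>)
    have y_block: "block (y (Suc k) \<omega> - ustar) i
        = v i (x k \<omega>) + (\<Sum>j\<in>{i}. (- \<alpha>) *\<^sub>R e j (x k \<omega>) (\<xi> j k \<omega>))" for i \<omega>
      by (simp add: step_y linear_add[OF linear_block] linear_diff[OF linear_block] linear_scale[OF linear_block] block_stack
          v_def e_def algebra_simps)
    have block_int: "integrable M (\<lambda>\<omega>. (norm (block (y (Suc k) \<omega> - ustar) i))\<^sup>2)" for i
      using noise[OF v_meas[of i] int_v[of i], of "- \<alpha>" "{i}"] by (simp only: y_block)
    have block_E: "expectation (\<lambda>\<omega>. (norm (block (y (Suc k) \<omega> - ustar) i))\<^sup>2)
        \<le> (1 - \<nu>) * expectation (\<lambda>\<omega>. (norm (block (x k \<omega> - ustar) i))\<^sup>2) + \<alpha>\<^sup>2 * \<sigma>\<^sup>2" for i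
    proof -
      have "expectation (\<lambda>\<omega>. (norm (block (y (Suc k) \<omega> - ustar) i))\<^sup>2)
          \<le> expectation (\<lambda>\<omega>. (norm (v i (x k \<omega>)))\<^sup>2) + \<alpha>\<^sup>2 * \<sigma>\<^sup>2"
        using noise[OF v_meas[of i] int_v[of i], of "- \<alpha>" "{i}"] unfolding y_block by simp
      moreover have "expectation (\<lambda>\<omega>. (norm (v i (x k \<omega>)))\<^sup>2)
          \<le> expectation (\<lambda>\<omega>. (1 - \<nu>) * (norm (block (x k \<omega> - ustar) i))\<^sup>2)"
        by (intro integral_mono int_v v_le integrable_mult_right int_block)
      ultimately show ?thesis by simp
    qed
    have "A (Suc k) = (\<Sum>i\<in>UNIV. expectation (\<lambda>\<omega>. (norm (block (y (Suc k) \<omega> - ustar) i))\<^sup>2))"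
      unfolding A_def norm_sq_eq_sum_block by (rule Bochner_Integration.integral_sum[OF block_int])
    also have "\<dots> \<le> (\<Sum>i\<in>UNIV. (1 - \<nu>) * expectation (\<lambda>\<omega>. (norm (block (x k \<omega> - ustar) i))\<^sup>2) + \<alpha>\<^sup>2 * \<sigma>\<^sup>2)"
      by (intro sum_mono block_E)
    also have "\<dots> = (1 - \<nu>) * (\<Sum>i\<in>UNIV. expectation (\<lambda>\<omega>. (norm (block (x k \<omega> - ustar) i))\<^sup>2)) + \<Delta>"
      by (simp add: sum.distrib sum_distrib_left assms(22) mult_ac)
    also have "(\<Sum>i\<in>UNIV. expectation (\<lambda>\<omega>. (norm (block (x k \<omega> - ustar) i))\<^sup>2))
        = expectation (\<lambda>\<omega>. (norm (x k \<omega> - ustar))\<^sup>2)"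
      unfolding norm_sq_eq_sum_block by (rule Bochner_Integration.integral_sum[OF int_block, symmetric])
    also have "(1 - \<nu>) * expectation (\<lambda>\<omega>. (norm (x k \<omega> - ustar))\<^sup>2) + \<Delta>
        \<le> (1 - \<nu>) * ((1 + \<nu>) * B + 4 * (1 + inverse \<nu>) * (norm ustar)\<^sup>2) + \<Delta>"
      using \<nu> AB by (intro add_right_mono mult_left_mono order_trans[OF Ex] mult_left_mono) auto
    also have "\<dots> \<le> B"
    proof -
      have "B - ((1 - \<nu>) * ((1 + \<nu>) * B + 4 * (1 + inverse \<nu>) * (norm ustar)\<^sup>2) + \<Delta>)
          = \<nu>\<^sup>2 * (norm (y0 - ustar))\<^sup>2 + 4 * \<nu> * (norm ustar)\<^sup>2"
        using \<nu>(1) by (simp add: B_def field_simps power2_eq_square power3_eq_cube)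
      moreover have "0 \<le> \<nu>\<^sup>2 * (norm (y0 - ustar))\<^sup>2 + 4 * \<nu> * (norm ustar)\<^sup>2" using \<nu> by simp
      ultimately show ?thesis by linarith
    qed
    finally have "A (Suc k) \<le> B" .
    moreover have "integrable M (\<lambda>\<omega>. (norm (y (Suc k) \<omega> - ustar))\<^sup>2)"
      unfolding norm_sq_eq_sum_block by (rule Bochner_Integration.integrable_sum[OF block_int])
    ultimately show ?case by blast
  qed
  have y_sq: "integrable M (\<lambda>\<omega>. (norm (y k \<omega>))\<^sup>2)" "expectation (\<lambda>\<omega>. (norm (y k \<omega>))\<^sup>2) \<le> Dsq" for k
  proof -
    let ?b = "\<lambda>\<omega>. 2 * (norm (y k \<omega> - ustar))\<^sup>2 + 2 * (norm ustar)\<^sup>2"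
    have le: "(norm (y k \<omega>))\<^sup>2 \<le> ?b \<omega>" for \<omega>
      using norm_add_sq_le[of 1 "y k \<omega> - ustar" ustar] by simp
    have b: "integrable M ?b" using y_bound by simp
    show int: "integrable M (\<lambda>\<omega>. (norm (y k \<omega>))\<^sup>2)"
      by (rule Bochner_Integration.integrable_bound[OF b]) (use le in auto)
    have "expectation (\<lambda>\<omega>. (norm (y k \<omega>))\<^sup>2) \<le> expectation ?b"
      by (intro integral_mono int b le)
    also have "\<dots> = 2 * A k + 2 * (norm ustar)\<^sup>2" using y_bound by (simp add: A_def prob_space)
    also have "\<dots> \<le> 2 * B + 2 * (norm ustar)\<^sup>2" using y_bound[of k] by simp
    also have "\<dots> = Dsq" using \<nu>(1) by (simp add: assms(23) B_def field_simps)
    finally show "expectation (\<lambda>\<omega>. (norm (y k \<omega>))\<^sup>2) \<le> Dsq" .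
  qed

  \<comment> \<open>One-step recursion for the average\<close>
  define R where "R = \<alpha>\<^sup>2 * \<sigma>\<^sup>2 / n"
  define err where "err k = expectation (\<lambda>\<omega>. (norm (avg (x k \<omega>) - xstar))\<^sup>2)" for k
  have avg_x: "avg (x k \<omega>) = avg (y k \<omega>)" for k \<omega>
    unfolding step_x assms(4) by (rule avg_consensus[OF net])
  \<comment> \<open>The averaged step without noise. Its gradients are taken at the local copies,
    not at their average; \<open>d\<close> below measures that difference.\<close>
  define V where "V u = avg u - xstar - (\<alpha> / n) *\<^sub>R (\<Sum>i\<in>UNIV. grad (f i) (block u i))" for u
  have V_meas[measurable]: "V \<in> borel_measurable borel" unfolding V_def by measurable
  have V_le: "(norm (V (x k \<omega>)))\<^sup>2 \<le> c1 * (norm (avg (x k \<omega>) - xstar))\<^sup>2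
      + \<alpha>\<^sup>2 * (1 + inverse \<psi>) * L\<^sup>2 * ((\<beta> ^ k)\<^sup>2 * (norm (y k \<omega>))\<^sup>2)" for k \<omega>
  proof -
    define w where "w = avg (x k \<omega>)"
    define d where "d i = grad (f i) w - grad (f i) (block (x k \<omega>) i)" for i
    have d_le: "(norm (d i))\<^sup>2 \<le> L\<^sup>2 * (norm (block (x k \<omega>) i - w))\<^sup>2" for i
    proof -
      have "norm (d i) \<le> L * norm (block (x k \<omega>) i - w)"
        using lipschitz_onD[OF L_lip, of w "block (x k \<omega>) i" i] by (simp add: d_def dist_norm norm_minus_commute)
      then have "(norm (d i))\<^sup>2 \<le> (L * norm (block (x k \<omega>) i - w))\<^sup>2" by (intro power_mono) auto
      then show ?thesis by (simp add: power_mult_distrib)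
    qed
    have "V (x k \<omega>) = ((w - \<alpha> *\<^sub>R gavg w) - (xstar - \<alpha> *\<^sub>R gavg xstar)) + (\<alpha> / n) *\<^sub>R (\<Sum>i\<in>UNIV. d i)"
      by (simp add: V_def w_def[symmetric] d_def sum_subtractf gavg_def xstar[unfolded gavg_def] algebra_simps)
    then have "(norm (V (x k \<omega>)))\<^sup>2 \<le> (1 + \<psi>) * (norm ((w - \<alpha> *\<^sub>R gavg w) - (xstar - \<alpha> *\<^sub>R gavg xstar)))\<^sup>2
        + (1 + inverse \<psi>) * (norm ((\<alpha> / n) *\<^sub>R (\<Sum>i\<in>UNIV. d i)))\<^sup>2"
      using norm_add_sq_le[OF \<psi>] by metis
    also have "\<dots> \<le> (1 + \<psi>) * ((1 - 2 * \<alpha> * \<gamma>f) * (norm (w - xstar))\<^sup>2)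
        + (1 + inverse \<psi>) * (\<alpha>\<^sup>2 * (L\<^sup>2 * ((\<beta> ^ k)\<^sup>2 * (norm (y k \<omega>))\<^sup>2)))"
    proof (intro add_mono mult_left_mono)
      show "(norm ((w - \<alpha> *\<^sub>R gavg w) - (xstar - \<alpha> *\<^sub>R gavg xstar)))\<^sup>2 \<le> (1 - 2 * \<alpha> * \<gamma>f) * (norm (w - xstar))\<^sup>2"
        unfolding assms(26)
        by (rule gradient_step_contraction[OF favg_grad favg_lip favg_conv \<alpha>(1) \<alpha>_favg])
      have "(norm (\<Sum>i\<in>UNIV. d i))\<^sup>2 \<le> n * (\<Sum>i\<in>UNIV. (norm (d i))\<^sup>2)"
        unfolding n_def by (rule norm_sum_sq_le)
      also have "\<dots> \<le> n * (\<Sum>i\<in>UNIV. L\<^sup>2 * (norm (block (x k \<omega>) i - w))\<^sup>2)"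
        using n by (intro mult_left_mono sum_mono d_le) auto
      also have "\<dots> = n * (L\<^sup>2 * (\<Sum>i\<in>UNIV. (norm (block (x k \<omega>) i - w))\<^sup>2))"
        by (simp add: sum_distrib_left)
      also have "\<dots> \<le> n * (L\<^sup>2 * ((\<beta> ^ k)\<^sup>2 * (norm (y k \<omega>))\<^sup>2))"
        unfolding w_def avg_x unfolding step_x assms(4,5)
        using n by (intro mult_left_mono consensus_disagreement_le[OF net]) auto
      \<comment> \<open>A factor n is given away so that division by n^2 leaves a bound free of n,
        as in \<open>c2sq\<close>.\<close>
      also have "\<dots> \<le> n\<^sup>2 * (L\<^sup>2 * ((\<beta> ^ k)\<^sup>2 * (norm (y k \<omega>))\<^sup>2))"
        using n by (intro mult_right_mono) (auto simp: power2_eq_square)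
      finally have "(norm (\<Sum>i\<in>UNIV. d i))\<^sup>2 / n\<^sup>2 \<le> L\<^sup>2 * ((\<beta> ^ k)\<^sup>2 * (norm (y k \<omega>))\<^sup>2)"
        using n by (simp add: divide_le_eq mult.commute)
      then have "\<alpha>\<^sup>2 * ((norm (\<Sum>i\<in>UNIV. d i))\<^sup>2 / n\<^sup>2) \<le> \<alpha>\<^sup>2 * (L\<^sup>2 * ((\<beta> ^ k)\<^sup>2 * (norm (y k \<omega>))\<^sup>2))"
        by (intro mult_left_mono) auto
      then show "(norm ((\<alpha> / n) *\<^sub>R (\<Sum>i\<in>UNIV. d i)))\<^sup>2 \<le> \<alpha>\<^sup>2 * (L\<^sup>2 * ((\<beta> ^ k)\<^sup>2 * (norm (y k \<omega>))\<^sup>2))"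
        by (simp add: power_mult_distrib power_divide)
    qed (use \<psi> in auto)
    finally show ?thesis by (simp add: w_def assms(29) mult_ac)
  qed
  have err_step: "integrable M (\<lambda>\<omega>. (norm (avg (x (Suc k) \<omega>) - xstar))\<^sup>2)
      \<and> err (Suc k) \<le> c1 * err k + c2sq * (\<beta>\<^sup>2) ^ k + R"
    if int: "integrable M (\<lambda>\<omega>. (norm (avg (x k \<omega>) - xstar))\<^sup>2)" for k
  proof -
    let ?b = "\<lambda>\<omega>. c1 * (norm (avg (x k \<omega>) - xstar))\<^sup>2
      + \<alpha>\<^sup>2 * (1 + inverse \<psi>) * L\<^sup>2 * ((\<beta> ^ k)\<^sup>2 * (norm (y k \<omega>))\<^sup>2)"
    have b: "integrable M ?b" using int y_sq by simp
    have int_V: "integrable M (\<lambda>\<omega>. (norm (V (x k \<omega>)))\<^sup>2)"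
    proof (rule Bochner_Integration.integrable_bound[OF b])
      show "AE \<omega> in M. norm ((norm (V (x k \<omega>)))\<^sup>2) \<le> norm (?b \<omega>)"
        using V_le by (intro AE_I2) (simp add: order_trans[OF _ abs_ge_self])
    qed measurable
    have "expectation (\<lambda>\<omega>. (norm (V (x k \<omega>)))\<^sup>2) \<le> expectation ?b"
      by (intro integral_mono int_V b V_le)
    also have "\<dots> = c1 * err k + \<alpha>\<^sup>2 * (1 + inverse \<psi>) * L\<^sup>2 * ((\<beta> ^ k)\<^sup>2 * expectation (\<lambda>\<omega>. (norm (y k \<omega>))\<^sup>2))"
      using int y_sq(1) by (simp add: err_def)
    also have "\<dots> \<le> c1 * err k + \<alpha>\<^sup>2 * (1 + inverse \<psi>) * L\<^sup>2 * ((\<beta> ^ k)\<^sup>2 * Dsq)"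
      using \<psi> by (intro add_left_mono mult_left_mono y_sq(2)) auto
    also have "\<dots> = c1 * err k + c2sq * (\<beta>\<^sup>2) ^ k"
      by (simp add: assms(30) power_even_eq[symmetric] power_mult[symmetric] mult_ac)
    finally have EV: "expectation (\<lambda>\<omega>. (norm (V (x k \<omega>)))\<^sup>2) \<le> c1 * err k + c2sq * (\<beta>\<^sup>2) ^ k" .
    have eq: "avg (x (Suc k) \<omega>) - xstar
        = V (x k \<omega>) + (\<Sum>i\<in>UNIV. (- (\<alpha> / n)) *\<^sub>R e i (x k \<omega>) (\<xi> i k \<omega>))" for \<omega>
      unfolding avg_x
      by (simp add: step_y avg_def V_def e_def n_def linear_add[OF linear_block] linear_diff[OF linear_block] linear_scale[OF linear_block]
          block_stack sum_subtractf sum.distrib scaleR_sum_right[symmetric] sum_negf algebra_simps)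
    have "(- (\<alpha> / n))\<^sup>2 * (real CARD('n) * \<sigma>\<^sup>2) = R"
      using n by (simp add: R_def n_def[symmetric] power2_eq_square field_simps)
    then show ?thesis
      using noise[OF V_meas int_V, of "- (\<alpha> / n)" UNIV] EV unfolding err_def eq by linarith
  qed

  \<comment> \<open>Solving the recursion\<close>
  have \<theta>: "\<beta>\<^sup>2 \<le> \<theta>" "(c1 + 1) / 2 \<le> \<theta>" "0 \<le> \<theta>" "\<theta> < 1"
    using c1 \<beta> by (auto simp: assms(32) power_less_one_iff le_max_iff_disj power2_eq_square mult_strict_mono[of \<beta> 1 \<beta> 1, simplified])
  have C: "(norm (avg y0 - xstar))\<^sup>2 \<le> C" "c2sq \<le> C * ((1 - c1) / 2)" "0 \<le> C"
  proof -
    show C0: "(norm (avg y0 - xstar))\<^sup>2 \<le> C" by (simp add: assms(31))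
    show "0 \<le> C" by (rule order_trans[OF _ C0]) simp
    have "2 * c2sq / (1 - c1) \<le> C" by (simp add: assms(31))
    then show "c2sq \<le> C * ((1 - c1) / 2)" using c1 by (simp add: field_simps)
  qed
  have c2: "0 \<le> c2sq"
  proof -
    have "0 \<le> expectation (\<lambda>\<omega>. (norm (y 0 \<omega>))\<^sup>2)" by simp
    also have "\<dots> \<le> Dsq" by (rule y_sq(2))
    finally show ?thesis using \<psi> by (simp add: assms(30))
  qed
  have "integrable M (\<lambda>\<omega>. (norm (avg (x k \<omega>) - xstar))\<^sup>2) \<and> err k \<le> C * \<theta> ^ k + R / (1 - c1)" for k
  proof (induction k)
    case 0
    have "0 \<le> R / (1 - c1)" using n c1 by (simp add: R_def)
    then show ?case using C(1) by (simp add: err_def avg_x y0 prob_space)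
  next
    case (Suc k)
    have "err (Suc k) \<le> c1 * err k + c2sq * (\<beta>\<^sup>2) ^ k + R" using err_step Suc by blast
    \<comment> \<open>\<open>R / (1 - c1)\<close> is the fixed point of e -> \<open>c1\<close> e +
      \<open>R\<close> and reproduces itself. The choice of \<open>C\<close> bounds the disagreement
      by half the gap times \<open>C * \<theta> ^ k\<close>, and \<open>c1\<close> + (1 -
      \<open>c1\<close>) / 2 = (\<open>c1\<close> + 1) / 2 <= \<theta>.\<close>
    also have "\<dots> \<le> c1 * (C * \<theta> ^ k + R / (1 - c1)) + C * ((1 - c1) / 2) * \<theta> ^ k + R"
      using Suc c1 \<theta> C c2 by (intro add_right_mono add_mono mult_left_mono mult_mono power_mono) auto
    also have "\<dots> = C * \<theta> ^ k * ((c1 + 1) / 2) + R / (1 - c1)"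
      using c1 by (simp add: field_simps)
    also have "\<dots> \<le> C * \<theta> ^ k * \<theta> + R / (1 - c1)"
      using C \<theta> by (intro add_right_mono mult_left_mono) auto
    finally show ?case using err_step Suc by (simp add: mult_ac)
  qed
  then show ?thesis using \<theta>(4) by (simp add: err_def R_def n_def field_simps)
qed

end
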